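(* Let $G$ and $Q$ be finite groups. Given two $G$-injective square-lattice PEPS invariant under a global on-site symmetry of $Q$, there is a continuous path (of symmetric $G$-injective PEPS, at finite system size and with no spectral gap requirement) connecting both if the classes of the maps $(\phi,\omega)$ associated with the two symmetric PEPS are the same.
   Context: A square-lattice PEPS tensor is a linear map $A: V\otimes V\otimes V^*\otimes V^*\to\mathcal{H}$ (up, right, down, left legs; $V$, $\mathcal H$ finite-dimensional). Write $A(Y\otimes X\otimes Y^{-1}\otimes X^{-1}):=A\circ(Y\otimes X\otimes (Y^{-1})^{T}\otimes (X^{-1})^{T})$. The state $|\Psi_A\rangle$ on a torus is obtained by contracting neighbouring legs (right with left, up with down). $A$ is $G$-injective if, for a representation $u_g$ of $G$ on $V$ containing every irreducible representation of $G$, $A=A(u_g\otimes u_g\otimes u_g^{-1}\otimes u_g^{-1})$ for all $g$ and there is $A^{-1}$ with $A^{-1}A=\frac{1}{|G|}\sum_g u_g\otimes u_g\otimes (u_g^{-1})^T\otimes (u_g^{-1})^T$. Invariance under a global on-site symmetry of $Q$: there is a linear representation $U_q$ of $Q$ on $\mathcal H$ and invertible matrices $v_q$ on $V$ with $U_qA=A(v_q\otimes v_q\otimes v_q^{-1}\otimes v_q^{-1})$ (so that $U_q^{\otimes}|\Psi_A\rangle=|\Psi_A\rangle$). Scalar phases are dropped, i.e. $v_qu_gv_q^{-1}=u_{\phi_q(g)}$ and $v_kv_q=u_{\omega(k,q)}v_{kq}$, which defines $\phi_q\in\mathrm{Aut}(G)$ and $\omega:Q\times Q\to G$. The pairs $(\phi,\omega)$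 and $(\phi',\omega')$ are in the same class if there are $g_q\in G$ such that $\phi'_k=\tau_{g_k}\circ\phi_k$ and $\omega'(k,q)=g_k\phi_k(g_q)\omega(k,q)g_{kq}^{-1}$ for all $k,q\in Q$, with $\tau_g$ conjugation by $g$. Continuous path connecting the symmetric tensors $(A_0,U^0)$, with physical space $\mathcal H_0$, and $(A_1,U^1)$, with physical space $\mathcal H_1$: a finite-dimensional space $\mathcal H\supseteq\mathcal H_0\oplus\mathcal H_1$ with a linear representation $U_q$ of $Q$ extending $U^0_q\oplus U^1_q$, and a continuous family $A(\lambda)$, $\lambda\in[0,1]$, of PEPS tensors with physical space $\mathcal H$ and a fixed bond space, such that the PEPS at the two extreme points $\lambda=0,1$ are the two given PEPS, $A(\lambda)$ is $G$-injective for every $\lambda\in(0,1)$, and the PEPS generated by $A(\lambda)$ is invariant under the on-site symmetry $U_q$ for every $\lambda$ and every system size. *)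

theory Defs
  imports Complex_Main "Jordan_Normal_Form.VS_Connect"
begin

text \<open>
  All vector spaces are complex and finite-dimensional, presented as coordinate spaces:
  the bond space is \<open>V = \<complex>^D\<close> and the physical space is \<open>H = \<complex>^d\<close>; linear maps are matrices,
  and \<open>V*\<close> carries the dual basis.
\<close>


subsection \<open>Representations\<close>

definition GL :: "nat \<Rightarrow> complex mat monoid" where
  "GL n = units_of (ring_mat TYPE(complex) n ())"

definition irreducible_rep :: "('g, 'x) monoid_scheme \<Rightarrow> nat \<Rightarrow> ('g \<Rightarrow> complex mat) \<Rightarrow> bool" where
  "irreducible_rep G n \<rho> \<longleftrightarrow>
     \<rho> \<in> hom G (GL n) \<and> n > 0 \<and>
     (\<forall>W. subspace class_ring W (module_vec TYPE(complex) n) \<and>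
          (\<forall>g\<in>carrier G. \<forall>w\<in>W. \<rho> g *\<^sub>v w \<in> W) \<longrightarrow>
          W = {0\<^sub>v n} \<or> W = carrier_vec n)"

text \<open>\<open>u\<close> (on \<open>\<complex>^D\<close>) contains \<open>\<rho>\<close> (on \<open>\<complex>^n\<close>) as a subrepresentation: there is an injective
  intertwiner \<open>T\<close> from \<open>\<rho>\<close> to \<open>u\<close>.\<close>

definition contains_rep ::
  "('g, 'x) monoid_scheme \<Rightarrow> nat \<Rightarrow> ('g \<Rightarrow> complex mat) \<Rightarrow> nat \<Rightarrow> ('g \<Rightarrow> complex mat) \<Rightarrow> bool" where
  "contains_rep G D u n \<rho> \<longleftrightarrow>
     (\<exists>T\<in>carrier_mat D n.
        (\<forall>x\<in>carrier_vec n. T *\<^sub>v x = 0\<^sub>v D \<longrightarrow> x = 0\<^sub>v n) \<and>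
        (\<forall>g\<in>carrier G. u g * T = T * \<rho> g))"


subsection \<open>PEPS tensors and G-injectivity\<close>

definition kron :: "complex mat \<Rightarrow> complex mat \<Rightarrow> complex mat" where
  "kron A B = mat (dim_row A * dim_row B) (dim_col A * dim_col B)
     (\<lambda>(i, j). A $$ (i div dim_row B, j div dim_col B) * B $$ (i mod dim_row B, j mod dim_col B))"

text \<open>A PEPS tensor \<open>A : V \<otimes> V \<otimes> V* \<otimes> V* \<rightarrow> H\<close> is a matrix in \<open>carrier_mat d (D ^ 4)\<close>. The column
  belonging to the basis vector with leg values up \<open>a\<close>, right \<open>b\<close>, down \<open>c\<close>, left \<open>e\<close> is the
  one that matches the index convention of \<^const>\<open>kron\<close>.\<close>

definition leg_index :: "nat \<Rightarrow> nat \<Rightarrow> nat \<Rightarrow> nat \<Rightarrow> nat \<Rightarrow> nat" where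
  "leg_index D a b c e = ((a * D + b) * D + c) * D + e"

text \<open>\<open>A(Y \<otimes> X \<otimes> Y\<inverse> \<otimes> X\<inverse>)\<close> is \<open>A * bond_op D Y X\<close>.\<close>

definition bond_op :: "nat \<Rightarrow> complex mat \<Rightarrow> complex mat \<Rightarrow> complex mat" where
  "bond_op D Y X =
     kron (kron (kron Y X) (transpose_mat (inv\<^bsub>GL D\<^esub> Y))) (transpose_mat (inv\<^bsub>GL D\<^esub> X))"

definition G_injective_wrt ::
  "('g, 'x) monoid_scheme \<Rightarrow> nat \<Rightarrow> nat \<Rightarrow> complex mat \<Rightarrow> ('g \<Rightarrow> complex mat) \<Rightarrow> bool" where
  "G_injective_wrt G D d A u \<longleftrightarrow>
     A \<in> carrier_mat d (D ^ 4) \<and>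
     u \<in> hom G (GL D) \<and>
     (\<forall>n \<rho>. irreducible_rep G n \<rho> \<longrightarrow> contains_rep G D u n \<rho>) \<and>
     (\<forall>g\<in>carrier G. A = A * bond_op D (u g) (u g)) \<and>
     (\<exists>B\<in>carrier_mat (D ^ 4) d.
        B * A = (1 / of_nat (card (carrier G))) \<cdot>\<^sub>m
          (\<Oplus>\<^bsub>ring_mat TYPE(complex) (D ^ 4) ()\<^esub> g\<in>carrier G. bond_op D (u g) (u g)))"

definition G_injective ::
  "('g, 'x) monoid_scheme \<Rightarrow> nat \<Rightarrow> nat \<Rightarrow> complex mat \<Rightarrow> bool" where
  "G_injective G D d A \<longleftrightarrow> (\<exists>u. G_injective_wrt G D d A u)"


subsection \<open>States on the torus\<close>

definition sites :: "nat \<Rightarrow> nat \<Rightarrow> (nat \<times> nat) set" where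
  "sites L M = {..<L} \<times> {..<M}"

definition configs :: "nat \<Rightarrow> nat \<Rightarrow> nat \<Rightarrow> (nat \<times> nat \<Rightarrow> nat) set" where
  "configs L M d = sites L M \<rightarrow>\<^sub>E {..<d}"

text \<open>A vector of \<open>H\<^sup>\<otimes>\<^sup>L\<^sup>M\<close> is the function of its amplitudes on \<open>configs L M d\<close>, extended by
  \<^const>\<open>undefined\<close>, so that equality of states is equality of functions.

  In the state, \<open>w (x, y)\<close> is the value on the vertical bond joining the up leg of \<open>(x, y)\<close> to the
  down leg of \<open>(x, y + 1)\<close>, and \<open>h (x, y)\<close> the value on the horizontal bond joining the right leg
  of \<open>(x, y)\<close> to the left leg of \<open>(x + 1, y)\<close>, coordinates being cyclic.\<close>

definition peps_state ::
  "nat \<Rightarrow> nat \<Rightarrow> complex mat \<Rightarrow> nat \<Rightarrow> nat \<Rightarrow> (nat \<times> nat \<Rightarrow> nat) \<Rightarrow> complex" where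
  "peps_state D d A L M = restrict
     (\<lambda>p. \<Sum>w\<in>configs L M D. \<Sum>h\<in>configs L M D. \<Prod>(x, y)\<in>sites L M.
        A $$ (p (x, y),
              leg_index D (w (x, y)) (h (x, y))
                          (w (x, (y + M - 1) mod M)) (h ((x + L - 1) mod L, y))))
     (configs L M d)"

text \<open>The operator \<open>X\<^sup>\<otimes>\<^sup>L\<^sup>M\<close> for a linear map \<open>X\<close> between physical spaces.\<close>

definition onsite ::
  "complex mat \<Rightarrow> nat \<Rightarrow> nat \<Rightarrow> ((nat \<times> nat \<Rightarrow> nat) \<Rightarrow> complex) \<Rightarrow> (nat \<times> nat \<Rightarrow> nat) \<Rightarrow> complex" where
  "onsite X L M \<Psi> = restrict
     (\<lambda>p. \<Sum>p'\<in>configs L M (dim_col X). (\<Prod>s\<in>sites L M. X $$ (p s, p' s)) * \<Psi> p')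
     (configs L M (dim_row X))"


subsection \<open>On-site symmetry and its class\<close>

definition symmetric_peps ::
  "('g, 'x) monoid_scheme \<Rightarrow> ('q, 'y) monoid_scheme \<Rightarrow> nat \<Rightarrow> nat \<Rightarrow> complex mat \<Rightarrow>
   ('g \<Rightarrow> complex mat) \<Rightarrow> ('q \<Rightarrow> complex mat) \<Rightarrow> ('q \<Rightarrow> complex mat) \<Rightarrow>
   ('q \<Rightarrow> 'g \<Rightarrow> 'g) \<Rightarrow> ('q \<Rightarrow> 'q \<Rightarrow> 'g) \<Rightarrow> bool" where
  "symmetric_peps G Q D d A u U v \<phi> \<omega> \<longleftrightarrow>
     G_injective_wrt G D d A u \<and>
     U \<in> hom Q (GL d) \<and>
     (\<forall>q\<in>carrier Q. v q \<in> carrier (GL D)) \<and>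
     (\<forall>q\<in>carrier Q. U q * A = A * bond_op D (v q) (v q)) \<and>
     (\<forall>q\<in>carrier Q. \<phi> q \<in> iso G G) \<and>
     (\<forall>k\<in>carrier Q. \<forall>q\<in>carrier Q. \<omega> k q \<in> carrier G) \<and>
     (\<forall>q\<in>carrier Q. \<forall>g\<in>carrier G. v q * u g * inv\<^bsub>GL D\<^esub> (v q) = u (\<phi> q g)) \<and>
     (\<forall>k\<in>carrier Q. \<forall>q\<in>carrier Q. v k * v q = u (\<omega> k q) * v (k \<otimes>\<^bsub>Q\<^esub> q))"

definition same_class ::
  "('g, 'x) monoid_scheme \<Rightarrow> ('q, 'y) monoid_scheme \<Rightarrow>
   ('q \<Rightarrow> 'g \<Rightarrow> 'g) \<Rightarrow> ('q \<Rightarrow> 'q \<Rightarrow> 'g) \<Rightarrow> ('q \<Rightarrow> 'g \<Rightarrow> 'g) \<Rightarrow> ('q \<Rightarrow> 'q \<Rightarrow> 'g) \<Rightarrow> bool" where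
  "same_class G Q \<phi> \<omega> \<phi>' \<omega>' \<longleftrightarrow>
     (\<exists>\<gamma>\<in>carrier Q \<rightarrow> carrier G.
        (\<forall>k\<in>carrier Q. \<forall>h\<in>carrier G. \<phi>' k h = \<gamma> k \<otimes>\<^bsub>G\<^esub> \<phi> k h \<otimes>\<^bsub>G\<^esub> inv\<^bsub>G\<^esub> \<gamma> k) \<and>
        (\<forall>k\<in>carrier Q. \<forall>q\<in>carrier Q.
           \<omega>' k q = \<gamma> k \<otimes>\<^bsub>G\<^esub> \<phi> k (\<gamma> q) \<otimes>\<^bsub>G\<^esub> \<omega> k q \<otimes>\<^bsub>G\<^esub> inv\<^bsub>G\<^esub> \<gamma> (k \<otimes>\<^bsub>Q\<^esub> q)))"


subsection \<open>Paths\<close>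

text \<open>The inclusion of \<open>\<complex>^n\<close> into \<open>\<complex>^d\<close> as the coordinates \<open>s, \<dots>, s + n - 1\<close>.\<close>

definition incl_mat :: "nat \<Rightarrow> nat \<Rightarrow> nat \<Rightarrow> complex mat" where
  "incl_mat d s n = mat d n (\<lambda>(i, j). if i = s + j then 1 else 0)"

text \<open>\<open>H = \<complex>^d\<close> contains \<open>H\<^sub>0 \<oplus> H\<^sub>1\<close> as its first \<open>d0 + d1\<close> coordinates. The bond dimension \<open>D\<close> of the
  path may differ from those of the two given tensors, so at the end points it is the PEPS, that is,
  the states on all tori, that are prescribed, and not the tensors.\<close>

definition symmetric_path ::
  "('g, 'x) monoid_scheme \<Rightarrow> ('q, 'y) monoid_scheme \<Rightarrow>
   nat \<Rightarrow> nat \<Rightarrow> complex mat \<Rightarrow> ('q \<Rightarrow> complex mat) \<Rightarrow>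
   nat \<Rightarrow> nat \<Rightarrow> complex mat \<Rightarrow> ('q \<Rightarrow> complex mat) \<Rightarrow>
   nat \<Rightarrow> nat \<Rightarrow> (real \<Rightarrow> complex mat) \<Rightarrow> ('q \<Rightarrow> complex mat) \<Rightarrow> bool" where
  "symmetric_path G Q D0 d0 A0 U0 D1 d1 A1 U1 D d A U \<longleftrightarrow>
     d0 + d1 \<le> d \<and>
     U \<in> hom Q (GL d) \<and>
     (\<forall>q\<in>carrier Q. U q * incl_mat d 0 d0 = incl_mat d 0 d0 * U0 q \<and>
                    U q * incl_mat d d0 d1 = incl_mat d d0 d1 * U1 q) \<and>
     (\<forall>t\<in>{0..1}. A t \<in> carrier_mat d (D ^ 4)) \<and>
     (\<forall>i<d. \<forall>j<D ^ 4. continuous_on {0..1} (\<lambda>t. A t $$ (i, j))) \<and>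
     (\<forall>L>0. \<forall>M>0.
        peps_state D d (A 0) L M = onsite (incl_mat d 0 d0) L M (peps_state D0 d0 A0 L M) \<and>
        peps_state D d (A 1) L M = onsite (incl_mat d d0 d1) L M (peps_state D1 d1 A1 L M)) \<and>
     (\<forall>t\<in>{0<..<1}. G_injective G D d (A t)) \<and>
     (\<forall>t\<in>{0..1}. \<forall>q\<in>carrier Q. \<forall>L>0. \<forall>M>0.
        onsite (U q) L M (peps_state D d (A t) L M) = peps_state D d (A t) L M)"

end

theory Submission
  imports Defs
begin

text \<open>
  Multiplying \<open>v1 q\<close> by \<open>u1 (inv (\<gamma> q))\<close> changes neither \<open>A1\<close> nor \<open>U1\<close>, so both tensors may be
  assumed to have the same maps \<open>\<phi>\<close> and \<open>\<omega>\<close>. Then \<open>u = u0 \<oplus> u1\<close> and \<open>v = v0 \<oplus> v1\<close> on the bond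
  space \<open>V0 \<oplus> V1\<close> satisfy the same relations. Let \<open>P\<close> be the average of the gauge action of \<open>G\<close>
  on the four legs. The gauge action of \<open>Q\<close> through \<open>v\<close> commutes with \<open>P\<close>, and on its image the
  factors \<open>u (\<omega> k q)\<close> act trivially, so it becomes a linear representation there. With
  \<open>H = H0 \<oplus> H1 \<oplus> (V0 \<oplus> V1)\<^sup>\<otimes>\<^sup>4\<close>, the tensors
  \<open>A t = (1 - t) A0 \<oplus> t A1 \<oplus> t (1 - t) P\<close>, where \<open>A0\<close> and \<open>A1\<close> are extended by zero, all satisfy
  \<open>U q * A t = A t * bond_op D (v q) (v q)\<close>, and for \<open>0 < t < 1\<close> the third summand alone yields
  the left inverse that \<open>G\<close>-injectivity requires.
\<close>

section \<open>Sums over two-digit indices and entries of matrix products\<close>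

lemma sum_lessThan_mult:
  fixes f :: "nat \<Rightarrow> nat \<Rightarrow> 'a::comm_monoid_add"
  shows "(\<Sum>k<m * n. f (k div n) (k mod n)) = (\<Sum>i<m. \<Sum>j<n. f i j)"
proof -
  have "(\<Sum>k<m * n. f (k div n) (k mod n))
      = (\<Sum>i<m. \<Sum>k\<in>{i * n..<i * n + n}. f (k div n) (k mod n))"
    by (rule sum.nat_group[symmetric])
  also have "\<dots> = (\<Sum>i<m. \<Sum>j<n. f i j)"
  proof (rule sum.cong[OF refl])
    fix i
    have "(\<Sum>k\<in>{i * n..<i * n + n}. f (k div n) (k mod n))
        = (\<Sum>j\<in>{0..<n}. f ((j + i * n) div n) ((j + i * n) mod n))"
      using sum.shift_bounds_nat_ivl[of "\<lambda>k. f (k div n) (k mod n)" 0 "i * n" n]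
      by (simp add: add.commute)
    also have "\<dots> = (\<Sum>j<n. f i j)"
      by (simp add: lessThan_atLeast0)
    finally show "(\<Sum>k\<in>{i * n..<i * n + n}. f (k div n) (k mod n)) = (\<Sum>j<n. f i j)" .
  qed
  finally show ?thesis .
qed

lemma mult_add_less: "a < m \<Longrightarrow> b < n \<Longrightarrow> a * n + b < m * (n::nat)"
proof -
  assume "a < m" "b < n"
  then have "a * n + b < Suc a * n" "Suc a * n \<le> m * n"
    by (simp, intro mult_le_mono1, simp)
  then show ?thesis by (rule less_le_trans)
qed

lemma mat_mult_index:
  assumes "A \<in> carrier_mat m n" "B \<in> carrier_mat n p" "i < m" "j < p"
  shows "(A * B) $$ (i, j) = (\<Sum>k<n. A $$ (i, k) * B $$ (k, j))"
  using assms by (simp add: scalar_prod_def lessThan_atLeast0)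


subsection \<open>Kronecker products\<close>

lemma kron_carrier [intro]:
  "A \<in> carrier_mat m n \<Longrightarrow> B \<in> carrier_mat m' n' \<Longrightarrow> kron A B \<in> carrier_mat (m * m') (n * n')"
  by (auto simp: kron_def)

lemma kron_index:
  assumes "A \<in> carrier_mat m n" "B \<in> carrier_mat m' n'" "i < m * m'" "j < n * n'"
  shows "kron A B $$ (i, j) = A $$ (i div m', j div n') * B $$ (i mod m', j mod n')"
  using assms by (auto simp: kron_def)

lemma kron_index_pair:
  assumes "A \<in> carrier_mat m n" "B \<in> carrier_mat m' n'" "i < m" "i' < m'" "j < n" "j' < n'"
  shows "kron A B $$ (i * m' + i', j * n' + j') = A $$ (i, j) * B $$ (i', j')"
  using assms by (subst kron_index[OF assms(1,2)]) (auto simp: mult_add_less)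

text \<open>The inner summation index splits into a quotient and a remainder modulo
  \<open>n'\<close>. In these two digits the summand is a product, so the sum factors into the
  entries of \<open>A * C\<close> and \<open>B * D\<close>.\<close>

lemma kron_mult:
  assumes A: "A \<in> carrier_mat m n" and C: "C \<in> carrier_mat n p"
    and B: "B \<in> carrier_mat m' n'" and D: "D \<in> carrier_mat n' p'"
  shows "kron A B * kron C D = kron (A * C) (B * D)"
proof (rule eq_matI)
  have AC: "A * C \<in> carrier_mat m p" and BD: "B * D \<in> carrier_mat m' p'"
    using assms by auto
  note c = kron_carrier[OF A B] kron_carrier[OF C D] kron_carrier[OF AC BD]
  show "dim_row (kron A B * kron C D) = dim_row (kron (A * C) (B * D))"
    and "dim_col (kron A B * kron C D) = dim_col (kron (A * C) (B * D))"
    using c by auto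
  fix i j
  assume "i < dim_row (kron (A * C) (B * D))" "j < dim_col (kron (A * C) (B * D))"
  then have i: "i < m * m'" and j: "j < p * p'"
    using c by auto
  \<comment> \<open>The existence of an index below \<open>m * m'\<close> (and below
    \<open>p * p'\<close>) excludes division by zero in the digit bounds that follow.\<close>
  then have m': "m' > 0" and p': "p' > 0"
    by (auto intro!: Nat.gr0I)
  have ij: "i div m' < m" "i mod m' < m'" "j div p' < p" "j mod p' < p'"
    using i j m' p' by (auto simp: less_mult_imp_div_less)
  have "(kron A B * kron C D) $$ (i, j)
      = (\<Sum>k<n * n'. kron A B $$ (i, k) * kron C D $$ (k, j))"
    using c i j by (intro mat_mult_index)
  also have "\<dots> = (\<Sum>k<n * n'. (A $$ (i div m', k div n') * B $$ (i mod m', k mod n')) *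
      (C $$ (k div n', j div p') * D $$ (k mod n', j mod p')))"
    using i j by (intro sum.cong refl) (simp add: kron_index[OF A B] kron_index[OF C D])
  also have "\<dots> = (\<Sum>k<n. \<Sum>k'<n'. (A $$ (i div m', k) * B $$ (i mod m', k')) *
      (C $$ (k, j div p') * D $$ (k', j mod p')))"
    by (rule sum_lessThan_mult)
  also have "\<dots> = (\<Sum>k<n. A $$ (i div m', k) * C $$ (k, j div p')) *
      (\<Sum>k'<n'. B $$ (i mod m', k') * D $$ (k', j mod p'))"
    by (simp add: sum_product ac_simps)
  also have "\<dots> = kron (A * C) (B * D) $$ (i, j)"
    using ij by (simp add: kron_index[OF AC BD i j] mat_mult_index[OF A C] mat_mult_index[OF B D])
  finally show "(kron A B * kron C D) $$ (i, j) = kron (A * C) (B * D) $$ (i, j)" .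
qed

lemma kron_one: "kron (1\<^sub>m m) (1\<^sub>m n) = 1\<^sub>m (m * n)"
proof (rule eq_matI)
  fix i j assume "i < dim_row (1\<^sub>m (m * n) :: complex mat)" "j < dim_col (1\<^sub>m (m * n) :: complex mat)"
  then have i: "i < m * n" and j: "j < m * n" by auto
  then have "n > 0" by (auto intro!: Nat.gr0I)
  then have "i div n < m" "j div n < m" "i mod n < n" "j mod n < n"
    using i j by (auto simp: less_mult_imp_div_less)
  moreover have "i = j" if "i div n = j div n" "i mod n = j mod n"
    using that by (metis div_mult_mod_eq)
  ultimately show "kron (1\<^sub>m m) (1\<^sub>m n) $$ (i, j) = 1\<^sub>m (m * n) $$ (i, j)"
    using i j by (auto simp: kron_index[OF one_carrier_mat one_carrier_mat])
qed (auto simp: kron_def)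


subsection \<open>Operators on the four legs\<close>

text \<open>Unlike in \<open>bond_op\<close>, the operators on the four legs are independent and may
  be rectangular, so that gauge transformations and restrictions of the legs to a summand are
  treated alike.\<close>

definition leg_op :: "complex mat \<Rightarrow> complex mat \<Rightarrow> complex mat \<Rightarrow> complex mat \<Rightarrow> complex mat" where
  "leg_op Y X Y' X' = kron (kron (kron Y X) Y') X'"

lemma leg_op_carrier:
  assumes "Y \<in> carrier_mat m n" "X \<in> carrier_mat m n" "Y' \<in> carrier_mat m n" "X' \<in> carrier_mat m n"
  shows "leg_op Y X Y' X' \<in> carrier_mat (m ^ 4) (n ^ 4)"
proof -
  have "leg_op Y X Y' X' \<in> carrier_mat (m * m * m * m) (n * n * n * n)"
    unfolding leg_op_def using assms by (intro kron_carrier)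
  then show ?thesis by (simp add: eval_nat_numeral ac_simps)
qed

lemma leg_op_mult:
  assumes "Y \<in> carrier_mat l m" "X \<in> carrier_mat l m" "Y' \<in> carrier_mat l m" "X' \<in> carrier_mat l m"
    and "Z \<in> carrier_mat m n" "W \<in> carrier_mat m n" "Z' \<in> carrier_mat m n" "W' \<in> carrier_mat m n"
  shows "leg_op Y X Y' X' * leg_op Z W Z' W' = leg_op (Y * Z) (X * W) (Y' * Z') (X' * W')"
proof -
  note k = kron_carrier[OF kron_carrier[OF assms(1,2)] assms(3)]
    kron_carrier[OF kron_carrier[OF assms(5,6)] assms(7)]
  show ?thesis
    unfolding leg_op_def
    by (simp only: kron_mult[OF k(1,2) assms(4,8)]
        kron_mult[OF kron_carrier[OF assms(1,2)] kron_carrier[OF assms(5,6)] assms(3,7)]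
        kron_mult[OF assms(1,5) assms(2,6)])
qed

lemma leg_op_one: "leg_op (1\<^sub>m n) (1\<^sub>m n) (1\<^sub>m n) (1\<^sub>m n) = 1\<^sub>m (n ^ 4)"
  unfolding leg_op_def kron_one by (simp add: eval_nat_numeral ac_simps)

lemma leg_index_less:
  assumes "a < D" "b < D" "c < D" "e < D"
  shows "leg_index D a b c e < D ^ 4"
proof -
  have "leg_index D a b c e < D * D * D * D"
    unfolding leg_index_def using assms by (intro mult_add_less)
  then show ?thesis by (simp add: eval_nat_numeral ac_simps)
qed

text \<open>Each of the nested Kronecker products peels off one digit of the numbers that
  \<open>leg_index\<close> assembles in base \<open>m\<close> and base \<open>n\<close>, the left
  leg first.\<close>

lemma leg_op_index:
  assumes "Y \<in> carrier_mat m n" "X \<in> carrier_mat m n" "Y' \<in> carrier_mat m n" "X' \<in> carrier_mat m n"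
    and "a < m" "b < m" "c < m" "e < m" "a' < n" "b' < n" "c' < n" "e' < n"
  shows "leg_op Y X Y' X' $$ (leg_index m a b c e, leg_index n a' b' c' e')
    = Y $$ (a, a') * X $$ (b, b') * Y' $$ (c, c') * X' $$ (e, e')"
proof -
  note k2 = kron_carrier[OF assms(1,2)]
  note k3 = kron_carrier[OF k2 assms(3)]
  show ?thesis
    unfolding leg_op_def leg_index_def using assms(5-)
    by (simp add: kron_index_pair[OF k3 assms(4)] kron_index_pair[OF k2 assms(3)]
        kron_index_pair[OF assms(1,2)] mult_add_less)
qed

lemma sum_leg_index:
  fixes f :: "nat \<Rightarrow> 'a::comm_monoid_add"
  shows "(\<Sum>k<n ^ 4. f k) = (\<Sum>a<n. \<Sum>b<n. \<Sum>c<n. \<Sum>e<n. f (leg_index n a b c e))"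
proof -
  have split: "(\<Sum>k<m * n. g k) = (\<Sum>i<m. \<Sum>j<n. g (i * n + j))" for m and g :: "nat \<Rightarrow> 'a"
    using sum_lessThan_mult[of "\<lambda>i j. g (i * n + j)" n m] by simp
  have "n ^ 4 = n * n * n * n" by (simp add: eval_nat_numeral ac_simps)
  then show ?thesis by (simp add: split leg_index_def)
qed

subsection \<open>States on the torus\<close>

text \<open>The shifts in \<open>peps_state\<close> become maps of sites, so that bonds can be
  regrouped along bijections. Adding \<open>M\<close> first keeps the subtraction of 1 from
  truncating at 0.\<close>

definition down :: "nat \<Rightarrow> nat \<times> nat \<Rightarrow> nat \<times> nat" where
  "down M s = (fst s, (snd s + M - 1) mod M)"

definition left :: "nat \<Rightarrow> nat \<times> nat \<Rightarrow> nat \<times> nat" where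
  "left L s = ((fst s + L - 1) mod L, snd s)"

lemma finite_sites [simp]: "finite (sites L M)"
  by (simp add: sites_def)

lemma bij_betw_cyclic_pred:
  fixes M :: nat
  assumes "M > 0"
  shows "bij_betw (\<lambda>y. (y + M - 1) mod M) {..<M} {..<M}"
proof (rule bij_betwI[where g = "\<lambda>y. (y + 1) mod M"])
  fix y assume y: "y \<in> {..<M}"
  show "((y + M - 1) mod M + 1) mod M = y"
  proof -
    have "((y + M - 1) mod M + 1) mod M = (y + M - 1 + 1) mod M"
      by (rule mod_add_left_eq)
    also have "y + M - 1 + 1 = y + M" using assms by simp
    finally show ?thesis using y by simp
  qed
  show "((y + 1) mod M + M - 1) mod M = y"
  proof -
    have "((y + 1) mod M + M - 1) mod M = ((y + 1) mod M + (M - 1)) mod M"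
      using assms by simp
    also have "\<dots> = (y + 1 + (M - 1)) mod M"
      by (rule mod_add_left_eq)
    finally show ?thesis using y assms by simp
  qed
qed (use assms in auto)

lemma bij_betw_down: "M > 0 \<Longrightarrow> bij_betw (down M) (sites L M) (sites L M)"
  using bij_betw_map_prod[OF bij_betw_id bij_betw_cyclic_pred, of M "{..<L}"]
  unfolding sites_def by (rule bij_betw_cong[THEN iffD1, rotated]) (auto simp: down_def)

lemma bij_betw_left: "L > 0 \<Longrightarrow> bij_betw (left L) (sites L M) (sites L M)"
  using bij_betw_map_prod[OF bij_betw_cyclic_pred bij_betw_id, of L "{..<M}"]
  unfolding sites_def by (rule bij_betw_cong[THEN iffD1, rotated]) (auto simp: left_def)

lemma peps_state_eq:
  "peps_state D d A L M = restrict
     (\<lambda>p. \<Sum>w\<in>configs L M D. \<Sum>h\<in>configs L M D. \<Prod>s\<in>sites L M.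
        A $$ (p s, leg_index D (w s) (h s) (w (down M s)) (h (left L s))))
     (configs L M d)"
  unfolding peps_state_def
  by (intro arg_cong2[where f = restrict] ext sum.cong prod.cong refl)
    (auto simp: down_def left_def)

lemma configs_less: "w \<in> configs L M D \<Longrightarrow> s \<in> sites L M \<Longrightarrow> w s < D"
  by (auto simp: configs_def)

lemma config_leg_index_less:
  assumes "L > 0" "M > 0" "w \<in> configs L M D" "h \<in> configs L M D" "s \<in> sites L M"
  shows "leg_index D (w s) (h s) (w (down M s)) (h (left L s)) < D ^ 4"
  using assms bij_betw_down[of M L] bij_betw_left[of L M]
  by (intro leg_index_less configs_less) (auto simp: bij_betw_apply)

lemma prod_sum_configs:
  fixes f :: "nat \<times> nat \<Rightarrow> nat \<Rightarrow> complex"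
  shows "(\<Prod>s\<in>sites L M. \<Sum>i<d. f s i) = (\<Sum>p\<in>configs L M d. \<Prod>s\<in>sites L M. f s (p s))"
  unfolding configs_def by (rule prod_sum_PiE) auto

text \<open>Distributivity turns the product over sites of sums over the inserted physical index
  into one sum over configurations, which moves outside the bond sums. A rectangular
  \<open>X\<close> is allowed because inclusions of physical spaces are treated in this way
  too.\<close>

lemma peps_state_mult_physical:
  assumes X: "X \<in> carrier_mat d d'" and A: "A \<in> carrier_mat d' (D ^ 4)" and "L > 0" "M > 0"
  shows "peps_state D d (X * A) L M = onsite X L M (peps_state D d' A L M)"
proof
  fix p
  show "peps_state D d (X * A) L M p = onsite X L M (peps_state D d' A L M) p"
  proof (cases "p \<in> configs L M d")
    \<comment> \<open>Outside \<open>configs L M d\<close> both states are \<open>undefined\<close>,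
      being restrictions to the same set.\<close>
    case False
    then show ?thesis using X by (simp add: peps_state_eq onsite_def)
  next
    case True
    let ?ix = "\<lambda>w h s. leg_index D (w s) (h s) (w (down M s)) (h (left L s))"
    have "peps_state D d (X * A) L M p
       = (\<Sum>w\<in>configs L M D. \<Sum>h\<in>configs L M D. \<Prod>s\<in>sites L M.
           \<Sum>i<d'. X $$ (p s, i) * A $$ (i, ?ix w h s))"
      using True
      by (simp add: peps_state_eq, intro sum.cong prod.cong refl mat_mult_index[OF X A])
        (auto intro: configs_less config_leg_index_less[OF assms(3,4)])
    also have "\<dots> = (\<Sum>w\<in>configs L M D. \<Sum>h\<in>configs L M D. \<Sum>p'\<in>configs L M d'.
        (\<Prod>s\<in>sites L M. X $$ (p s, p' s)) * (\<Prod>s\<in>sites L M. A $$ (p' s, ?ix w h s)))"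
      by (simp add: prod_sum_configs prod.distrib)
    also have "\<dots> = (\<Sum>w\<in>configs L M D. \<Sum>p'\<in>configs L M d'. \<Sum>h\<in>configs L M D.
        (\<Prod>s\<in>sites L M. X $$ (p s, p' s)) * (\<Prod>s\<in>sites L M. A $$ (p' s, ?ix w h s)))"
      by (rule sum.cong[OF refl], rule sum.swap)
    also have "\<dots> = (\<Sum>p'\<in>configs L M d'. \<Sum>w\<in>configs L M D. \<Sum>h\<in>configs L M D.
        (\<Prod>s\<in>sites L M. X $$ (p s, p' s)) * (\<Prod>s\<in>sites L M. A $$ (p' s, ?ix w h s)))"
      by (rule sum.swap)
    also have "\<dots> = onsite X L M (peps_state D d' A L M) p"
      using True X by (simp add: onsite_def peps_state_eq sum_distrib_left)
    finally show ?thesis .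
  qed
qed

text \<open>For fixed \<alpha> and \<gamma> the sum over \<open>w\<close> factors over the sites
  into entries of \<open>Y * transpose_mat Y'\<close>, that is, into Kronecker deltas, which force
  \<gamma> to be \<alpha> shifted by \<pi>. Here \<alpha> and \<gamma> are the values at the two
  ends of the bonds.\<close>

lemma contract_bond:
  fixes F :: "('s \<Rightarrow> nat) \<Rightarrow> ('s \<Rightarrow> nat) \<Rightarrow> complex"
  assumes S: "finite S" and \<pi>: "bij_betw \<pi> S S"
    and Y: "Y \<in> carrier_mat m n" and Y': "Y' \<in> carrier_mat m n"
    and YY': "Y * transpose_mat Y' = 1\<^sub>m m"
  shows "(\<Sum>w\<in>S \<rightarrow>\<^sub>E {..<n}. \<Sum>\<alpha>\<in>S \<rightarrow>\<^sub>E {..<m}. \<Sum>\<gamma>\<in>S \<rightarrow>\<^sub>E {..<m}.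
        F \<alpha> \<gamma> * ((\<Prod>s\<in>S. Y $$ (\<alpha> s, w s)) * (\<Prod>s\<in>S. Y' $$ (\<gamma> s, w (\<pi> s)))))
    = (\<Sum>\<alpha>\<in>S \<rightarrow>\<^sub>E {..<m}. F \<alpha> (restrict (\<alpha> \<circ> \<pi>) S))"
    (is "(\<Sum>w\<in>?W. \<Sum>\<alpha>\<in>?C. \<Sum>\<gamma>\<in>?C. F \<alpha> \<gamma> * ?P \<alpha> \<gamma> w) = _")
proof -
  \<comment> \<open>Reindexing the second product by the inverse of the shift makes both factors at
    a site depend on the same value \<open>w s\<close>.\<close>
  define \<rho> where "\<rho> = the_inv_into S \<pi>"
  have \<rho>: "bij_betw \<rho> S S"
    unfolding \<rho>_def using \<pi> by (rule bij_betw_the_inv_into)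
  have \<rho>\<pi>: "\<rho> (\<pi> s) = s" if "s \<in> S" for s
    unfolding \<rho>_def using \<pi> that by (simp add: bij_betw_def the_inv_into_f_f)
  have \<pi>\<rho>: "\<pi> (\<rho> s) = s" if "s \<in> S" for s
    unfolding \<rho>_def using \<pi> that by (simp add: bij_betw_def f_the_inv_into_f)
  have \<pi>S: "\<pi> s \<in> S" if "s \<in> S" for s
    using \<pi> that by (rule bij_betw_apply)
  have \<rho>S: "\<rho> s \<in> S" if "s \<in> S" for s
    using \<rho> that by (rule bij_betw_apply)
  have fin: "finite ?W" "finite ?C"
    using S by (auto intro: finite_PiE)
  have delta: "(\<Sum>w\<in>?W. ?P \<alpha> \<gamma> w) = (if \<gamma> = restrict (\<alpha> \<circ> \<pi>) S then 1 else 0)"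
    if \<alpha>: "\<alpha> \<in> ?C" and \<gamma>: "\<gamma> \<in> ?C" for \<alpha> \<gamma>
  proof -
    have "?P \<alpha> \<gamma> w = (\<Prod>s\<in>S. Y $$ (\<alpha> s, w s) * Y' $$ (\<gamma> (\<rho> s), w s))" for w
    proof -
      have "(\<Prod>s\<in>S. Y' $$ (\<gamma> s, w (\<pi> s))) = (\<Prod>s\<in>S. Y' $$ (\<gamma> (\<rho> s), w (\<pi> (\<rho> s))))"
        by (rule prod.reindex_bij_betw[OF \<rho>, symmetric])
      then show ?thesis by (simp add: \<pi>\<rho> prod.distrib)
    qed
    then have "(\<Sum>w\<in>?W. ?P \<alpha> \<gamma> w)
        = (\<Sum>w\<in>?W. \<Prod>s\<in>S. Y $$ (\<alpha> s, w s) * Y' $$ (\<gamma> (\<rho> s), w s))"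
      by (simp only:)
    also have "\<dots> = (\<Prod>s\<in>S. \<Sum>x<n. Y $$ (\<alpha> s, x) * Y' $$ (\<gamma> (\<rho> s), x))"
      using S by (intro prod_sum_PiE[symmetric]) auto
    also have "\<dots> = (\<Prod>s\<in>S. if \<alpha> s = \<gamma> (\<rho> s) then 1 else 0)"
    proof (rule prod.cong[OF refl])
      fix s assume s: "s \<in> S"
      then have lt: "\<alpha> s < m" "\<gamma> (\<rho> s) < m"
        using \<alpha> \<gamma> \<rho>S by (auto simp: PiE_iff)
      have "(\<Sum>x<n. Y $$ (\<alpha> s, x) * Y' $$ (\<gamma> (\<rho> s), x))
          = (\<Sum>x<n. Y $$ (\<alpha> s, x) * transpose_mat Y' $$ (x, \<gamma> (\<rho> s)))"
        using Y' lt by (intro sum.cong) auto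
      also have "\<dots> = (Y * transpose_mat Y') $$ (\<alpha> s, \<gamma> (\<rho> s))"
        using Y Y' lt by (intro mat_mult_index[symmetric]) auto
      finally show "(\<Sum>x<n. Y $$ (\<alpha> s, x) * Y' $$ (\<gamma> (\<rho> s), x))
          = (if \<alpha> s = \<gamma> (\<rho> s) then 1 else 0)"
        using lt by (simp add: YY')
    qed
    also have "\<dots> = (if \<forall>s\<in>S. \<alpha> s = \<gamma> (\<rho> s) then 1 else 0)"
      using S by (auto intro: prod_zero)
    also have "(\<forall>s\<in>S. \<alpha> s = \<gamma> (\<rho> s)) \<longleftrightarrow> \<gamma> = restrict (\<alpha> \<circ> \<pi>) S"
    proof
      assume *: "\<forall>s\<in>S. \<alpha> s = \<gamma> (\<rho> s)"
      show "\<gamma> = restrict (\<alpha> \<circ> \<pi>) S"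
      proof
        fix s show "\<gamma> s = restrict (\<alpha> \<circ> \<pi>) S s"
          using * \<gamma> \<pi>S[of s] \<rho>\<pi>[of s] by (cases "s \<in> S") (auto simp: PiE_iff extensional_def)
      qed
    next
      assume "\<gamma> = restrict (\<alpha> \<circ> \<pi>) S"
      then show "\<forall>s\<in>S. \<alpha> s = \<gamma> (\<rho> s)" by (simp add: \<rho>S \<pi>\<rho>)
    qed
    finally show ?thesis .
  qed
  have "(\<Sum>w\<in>?W. \<Sum>\<alpha>\<in>?C. \<Sum>\<gamma>\<in>?C. F \<alpha> \<gamma> * ?P \<alpha> \<gamma> w)
      = (\<Sum>\<alpha>\<in>?C. \<Sum>w\<in>?W. \<Sum>\<gamma>\<in>?C. F \<alpha> \<gamma> * ?P \<alpha> \<gamma> w)"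
    by (rule sum.swap)
  also have "\<dots> = (\<Sum>\<alpha>\<in>?C. \<Sum>\<gamma>\<in>?C. \<Sum>w\<in>?W. F \<alpha> \<gamma> * ?P \<alpha> \<gamma> w)"
    by (rule sum.cong[OF refl], rule sum.swap)
  also have "\<dots> = (\<Sum>\<alpha>\<in>?C. \<Sum>\<gamma>\<in>?C. F \<alpha> \<gamma> * (if \<gamma> = restrict (\<alpha> \<circ> \<pi>) S then 1 else 0))"
    by (intro sum.cong refl) (simp add: delta flip: sum_distrib_left)
  also have "\<dots> = (\<Sum>\<alpha>\<in>?C. F \<alpha> (restrict (\<alpha> \<circ> \<pi>) S))"
  proof (rule sum.cong[OF refl])
    fix \<alpha> assume \<alpha>: "\<alpha> \<in> ?C"
    \<comment> \<open>The shifted configuration lies in the range of \<gamma>, so the delta selects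
      exactly one term.\<close>
    have "restrict (\<alpha> \<circ> \<pi>) S \<in> ?C"
      using \<alpha> \<pi>S by (auto simp: PiE_iff)
    then show "(\<Sum>\<gamma>\<in>?C. F \<alpha> \<gamma> * (if \<gamma> = restrict (\<alpha> \<circ> \<pi>) S then 1 else 0))
        = F \<alpha> (restrict (\<alpha> \<circ> \<pi>) S)"
      using fin(2) by (simp add: if_distrib[of "\<lambda>x. _ * x"] cong: if_cong)
  qed
  finally show ?thesis .
qed

text \<open>Both the gauge freedom of the bonds (\<open>Y\<close> invertible and \<open>Y'\<close> its contragredient) and the
  enlargement of the bond space (\<open>Y = Y'\<close> a coordinate projection) are instances.\<close>

lemma peps_state_mult_leg_op:
  assumes A: "A \<in> carrier_mat d (m ^ 4)"
    and Y: "Y \<in> carrier_mat m n" and X: "X \<in> carrier_mat m n"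
    and Y': "Y' \<in> carrier_mat m n" and X': "X' \<in> carrier_mat m n"
    and YY': "Y * transpose_mat Y' = 1\<^sub>m m" and XX': "X * transpose_mat X' = 1\<^sub>m m"
    and L: "L > 0" and M: "M > 0"
  shows "peps_state n d (A * leg_op Y X Y' X') L M = peps_state m d A L M"
proof
  fix p
  show "peps_state n d (A * leg_op Y X Y' X') L M p = peps_state m d A L M p"
  proof (cases "p \<in> configs L M d")
    case False
    then show ?thesis by (simp add: peps_state_eq)
  next
    case p: True
    let ?S = "sites L M" and ?C = "configs L M m" and ?W = "configs L M n"
    let ?PA = "\<lambda>\<alpha> \<beta> \<gamma> \<epsilon>. \<Prod>s\<in>?S. A $$ (p s, leg_index m (\<alpha> s) (\<beta> s) (\<gamma> s) (\<epsilon> s))"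
    let ?Y = "\<lambda>w \<alpha> \<gamma>. (\<Prod>s\<in>?S. Y $$ (\<alpha> s, w s)) * (\<Prod>s\<in>?S. Y' $$ (\<gamma> s, w (down M s)))"
    let ?X = "\<lambda>h \<beta> \<epsilon>. (\<Prod>s\<in>?S. X $$ (\<beta> s, h s)) * (\<Prod>s\<in>?S. X' $$ (\<epsilon> s, h (left L s)))"
    \<comment> \<open>At one site the inserted operator introduces four new indices below
      \<open>m\<close>, one for each leg; \<open>w\<close> and \<open>h\<close> keep their values
      below \<open>n\<close>.\<close>
    have site: "(A * leg_op Y X Y' X') $$ (p s, leg_index n (w s) (h s) (w (down M s)) (h (left L s)))
        = (\<Sum>a<m. \<Sum>b<m. \<Sum>c<m. \<Sum>e<m. A $$ (p s, leg_index m a b c e) *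
            (Y $$ (a, w s) * X $$ (b, h s) * Y' $$ (c, w (down M s)) * X' $$ (e, h (left L s))))"
      if w: "w \<in> ?W" and h: "h \<in> ?W" and s: "s \<in> ?S" for w h s
    proof -
      have dl: "down M s \<in> ?S" "left L s \<in> ?S"
        using s bij_betw_down[OF M, of L] bij_betw_left[OF L, of M] by (auto simp: bij_betw_apply)
      have "(A * leg_op Y X Y' X') $$ (p s, leg_index n (w s) (h s) (w (down M s)) (h (left L s)))
        = (\<Sum>k<m ^ 4. A $$ (p s, k) *
            leg_op Y X Y' X' $$ (k, leg_index n (w s) (h s) (w (down M s)) (h (left L s))))"
        using p s config_leg_index_less[OF L M w h s]
        by (intro mat_mult_index[OF A leg_op_carrier[OF Y X Y' X']]) (auto intro: configs_less)
      also have "\<dots> = (\<Sum>a<m. \<Sum>b<m. \<Sum>c<m. \<Sum>e<m. A $$ (p s, leg_index m a b c e) *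
          (Y $$ (a, w s) * X $$ (b, h s) * Y' $$ (c, w (down M s)) * X' $$ (e, h (left L s))))"
        unfolding sum_leg_index using w h s dl
        by (intro sum.cong refl) (simp add: leg_op_index[OF Y X Y' X'] configs_less)
      finally show ?thesis .
    qed
    have "peps_state n d (A * leg_op Y X Y' X') L M p
        = (\<Sum>w\<in>?W. \<Sum>h\<in>?W. \<Prod>s\<in>?S. \<Sum>a<m. \<Sum>b<m. \<Sum>c<m. \<Sum>e<m.
            A $$ (p s, leg_index m a b c e) *
            (Y $$ (a, w s) * X $$ (b, h s) * Y' $$ (c, w (down M s)) * X' $$ (e, h (left L s))))"
      using p by (simp add: peps_state_eq site)
    \<comment> \<open>The four sums at every site become sums over four configurations: \<alpha> and
      \<gamma> belong to the vertical bonds, \<beta> and \<epsilon> to the horizontal ones. The sums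
      are then reordered so that \<open>contract_bond\<close> removes first \<open>h\<close>, then
      \<open>w\<close>.\<close>
    also have "\<dots> = (\<Sum>w\<in>?W. \<Sum>h\<in>?W. \<Sum>\<alpha>\<in>?C. \<Sum>\<beta>\<in>?C. \<Sum>\<gamma>\<in>?C. \<Sum>\<epsilon>\<in>?C.
        ?PA \<alpha> \<beta> \<gamma> \<epsilon> * ?Y w \<alpha> \<gamma> * ?X h \<beta> \<epsilon>)"
      by (simp add: prod_sum_configs prod.distrib ac_simps)
    also have "\<dots> = (\<Sum>w\<in>?W. \<Sum>\<alpha>\<in>?C. \<Sum>h\<in>?W. \<Sum>\<beta>\<in>?C. \<Sum>\<gamma>\<in>?C. \<Sum>\<epsilon>\<in>?C.
        ?PA \<alpha> \<beta> \<gamma> \<epsilon> * ?Y w \<alpha> \<gamma> * ?X h \<beta> \<epsilon>)"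
      by (rule sum.cong[OF refl], rule sum.swap)
    also have "\<dots> = (\<Sum>w\<in>?W. \<Sum>\<alpha>\<in>?C. \<Sum>h\<in>?W. \<Sum>\<gamma>\<in>?C. \<Sum>\<beta>\<in>?C. \<Sum>\<epsilon>\<in>?C.
        ?PA \<alpha> \<beta> \<gamma> \<epsilon> * ?Y w \<alpha> \<gamma> * ?X h \<beta> \<epsilon>)"
      by (rule sum.cong[OF refl], rule sum.cong[OF refl], rule sum.cong[OF refl], rule sum.swap)
    also have "\<dots> = (\<Sum>w\<in>?W. \<Sum>\<alpha>\<in>?C. \<Sum>\<gamma>\<in>?C. \<Sum>h\<in>?W. \<Sum>\<beta>\<in>?C. \<Sum>\<epsilon>\<in>?C.
        ?PA \<alpha> \<beta> \<gamma> \<epsilon> * ?Y w \<alpha> \<gamma> * ?X h \<beta> \<epsilon>)"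
      by (rule sum.cong[OF refl], rule sum.cong[OF refl], rule sum.swap)
    also have "\<dots> = (\<Sum>w\<in>?W. \<Sum>\<alpha>\<in>?C. \<Sum>\<gamma>\<in>?C. \<Sum>\<beta>\<in>?C.
        ?PA \<alpha> \<beta> \<gamma> (restrict (\<beta> \<circ> left L) ?S) * ?Y w \<alpha> \<gamma>)"
      unfolding configs_def
      by (rule sum.cong[OF refl], rule sum.cong[OF refl], rule sum.cong[OF refl],
          rule contract_bond[OF finite_sites bij_betw_left[OF L] X X' XX'])
    also have "\<dots> = (\<Sum>w\<in>?W. \<Sum>\<alpha>\<in>?C. \<Sum>\<gamma>\<in>?C.
        (\<Sum>\<beta>\<in>?C. ?PA \<alpha> \<beta> \<gamma> (restrict (\<beta> \<circ> left L) ?S)) * ?Y w \<alpha> \<gamma>)"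
      by (simp add: sum_distrib_right)
    also have "\<dots> = (\<Sum>\<alpha>\<in>?C. \<Sum>\<beta>\<in>?C.
        ?PA \<alpha> \<beta> (restrict (\<alpha> \<circ> down M) ?S) (restrict (\<beta> \<circ> left L) ?S))"
      unfolding configs_def
      by (rule contract_bond[OF finite_sites bij_betw_down[OF M] Y Y' YY'])
    also have "\<dots> = peps_state m d A L M p"
      using p by (simp add: peps_state_eq)
    finally show ?thesis .
  qed
qed

subsection \<open>The general linear group\<close>

lemma group_GL: "group (GL n)"
proof -
  interpret ring "ring_mat TYPE(complex) n ()" by (rule ring_mat)
  show ?thesis unfolding GL_def by (rule units_group)
qed

lemma mult_GL [simp]: "X \<otimes>\<^bsub>GL n\<^esub> Y = X * Y"
  by (simp add: GL_def units_of_mult ring_mat_simps)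

lemma one_GL [simp]: "\<one>\<^bsub>GL n\<^esub> = 1\<^sub>m n"
  by (simp add: GL_def units_of_one ring_mat_simps)

lemma carrier_GL:
  "X \<in> carrier (GL n) \<longleftrightarrow>
    X \<in> carrier_mat n n \<and> (\<exists>Y\<in>carrier_mat n n. Y * X = 1\<^sub>m n \<and> X * Y = 1\<^sub>m n)"
  by (auto simp: GL_def units_of_carrier Units_def ring_mat_simps)

lemma GL_carrier_mat: "X \<in> carrier (GL n) \<Longrightarrow> X \<in> carrier_mat n n"
  by (simp add: carrier_GL)

lemma inv_GL_closed: "X \<in> carrier (GL n) \<Longrightarrow> inv\<^bsub>GL n\<^esub> X \<in> carrier (GL n)"
  using group.inv_closed[OF group_GL] .

lemma inv_GL_carrier_mat [intro]: "X \<in> carrier (GL n) \<Longrightarrow> inv\<^bsub>GL n\<^esub> X \<in> carrier_mat n n"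
  by (rule GL_carrier_mat[OF inv_GL_closed])

lemma inv_GL:
  assumes "X \<in> carrier (GL n)"
  shows "inv\<^bsub>GL n\<^esub> X * X = 1\<^sub>m n" "X * inv\<^bsub>GL n\<^esub> X = 1\<^sub>m n"
  using group.l_inv[OF group_GL assms] group.r_inv[OF group_GL assms] by simp_all

lemma inv_GL_mult:
  assumes "X \<in> carrier (GL n)" "Y \<in> carrier (GL n)"
  shows "inv\<^bsub>GL n\<^esub> (X * Y) = inv\<^bsub>GL n\<^esub> Y * inv\<^bsub>GL n\<^esub> X"
  using group.inv_mult_group[OF group_GL assms] by simp

lemma inv_GL_eqI:
  assumes "X \<in> carrier_mat n n" "Y \<in> carrier_mat n n" "Y * X = 1\<^sub>m n" "X * Y = 1\<^sub>m n"
  shows "X \<in> carrier (GL n)" "inv\<^bsub>GL n\<^esub> X = Y"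
proof -
  show X: "X \<in> carrier (GL n)" using assms by (auto simp: carrier_GL)
  have Y: "Y \<in> carrier (GL n)" using assms by (auto simp: carrier_GL)
  show "inv\<^bsub>GL n\<^esub> X = Y"
    using group.inv_equality[OF group_GL _ X Y] assms(3) by simp
qed

text \<open>\<open>contragredient n X\<close> is the operator induced by \<open>X\<close> on the dual legs.\<close>

abbreviation contragredient :: "nat \<Rightarrow> complex mat \<Rightarrow> complex mat" where
  "contragredient n X \<equiv> transpose_mat (inv\<^bsub>GL n\<^esub> X)"

lemma contragredient_carrier_mat: "X \<in> carrier (GL n) \<Longrightarrow> contragredient n X \<in> carrier_mat n n"
  by (simp add: inv_GL_carrier_mat)

text \<open>Inversion and transposition each reverse products, so together they keep the order. This
  makes \<open>bond_op\<close> multiplicative on all four legs.\<close>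

lemma contragredient_mult:
  assumes "X \<in> carrier (GL n)" "Y \<in> carrier (GL n)"
  shows "contragredient n (X * Y) = contragredient n X * contragredient n Y"
  unfolding inv_GL_mult[OF assms]
  by (rule transpose_mult[OF inv_GL_carrier_mat inv_GL_carrier_mat]) fact+

lemma bond_op_eq_leg_op:
  "bond_op n Y X = leg_op Y X (contragredient n Y) (contragredient n X)"
  by (simp add: bond_op_def leg_op_def)

lemma bond_op_carrier_mat:
  assumes "Y \<in> carrier (GL n)" "X \<in> carrier (GL n)"
  shows "bond_op n Y X \<in> carrier_mat (n ^ 4) (n ^ 4)"
  unfolding bond_op_eq_leg_op using assms
  by (intro leg_op_carrier GL_carrier_mat contragredient_carrier_mat)

lemma bond_op_mult:
  assumes "Y \<in> carrier (GL n)" "X \<in> carrier (GL n)" "Y' \<in> carrier (GL n)" "X' \<in> carrier (GL n)"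
  shows "bond_op n Y X * bond_op n Y' X' = bond_op n (Y * Y') (X * X')"
  unfolding bond_op_eq_leg_op contragredient_mult[OF assms(1,3)] contragredient_mult[OF assms(2,4)]
  by (rule leg_op_mult[OF GL_carrier_mat GL_carrier_mat
        contragredient_carrier_mat contragredient_carrier_mat
        GL_carrier_mat GL_carrier_mat contragredient_carrier_mat contragredient_carrier_mat])
    (fact assms)+

lemma bond_op_one: "bond_op n (1\<^sub>m n) (1\<^sub>m n) = 1\<^sub>m (n ^ 4)"
proof -
  have "inv\<^bsub>GL n\<^esub> (1\<^sub>m n) = 1\<^sub>m n" by (rule inv_GL_eqI) auto
  then show ?thesis by (simp add: bond_op_eq_leg_op leg_op_one)
qed

lemma bond_op_hom: "(\<lambda>Y. bond_op n Y Y) \<in> hom (GL n) (GL (n ^ 4))"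
proof (rule homI)
  fix Y assume Y: "Y \<in> carrier (GL n)"
  note Y' = inv_GL_closed[OF Y]
  show "bond_op n Y Y \<in> carrier (GL (n ^ 4))"
    by (rule inv_GL_eqI(1)[OF bond_op_carrier_mat[OF Y Y] bond_op_carrier_mat[OF Y' Y']])
      (simp_all add: bond_op_mult Y Y' inv_GL bond_op_one)
qed (simp add: bond_op_mult)

text \<open>Every bond meets an operator at one end and its contragredient at the other, and the two
  cancel.\<close>

lemma peps_state_mult_bond_op:
  assumes "A \<in> carrier_mat d (D ^ 4)" "Y \<in> carrier (GL D)" "X \<in> carrier (GL D)" "L > 0" "M > 0"
  shows "peps_state D d (A * bond_op D Y X) L M = peps_state D d A L M"
  unfolding bond_op_eq_leg_op using assms
  by (intro peps_state_mult_leg_op GL_carrier_mat contragredient_carrier_mat)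
    (simp_all add: inv_GL)


subsection \<open>Direct sums\<close>

lemma incl_mat_carrier [simp]: "incl_mat d s n \<in> carrier_mat d n"
  by (simp add: incl_mat_def)

text \<open>The transpose of an inclusion is the coordinate projection. This one formula covers both
  a projection undoing its own inclusion and the vanishing between disjoint blocks.\<close>

lemma transpose_incl_mult_incl:
  assumes "s + n \<le> d" "s' + n' \<le> d"
  shows "transpose_mat (incl_mat d s n) * incl_mat d s' n'
    = mat n n' (\<lambda>(i, j). if s + i = s' + j then 1 else 0)"
proof (rule eq_matI)
  fix i j
  assume "i < dim_row (mat n n' (\<lambda>(i, j). if s + i = s' + j then 1 else (0::complex)))"
    and "j < dim_col (mat n n' (\<lambda>(i, j). if s + i = s' + j then 1 else (0::complex)))"
  then have i: "i < n" and j: "j < n'" by auto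
  have "(transpose_mat (incl_mat d s n) * incl_mat d s' n') $$ (i, j)
      = (\<Sum>k<d. transpose_mat (incl_mat d s n) $$ (i, k) * incl_mat d s' n' $$ (k, j))"
    using i j by (intro mat_mult_index[of _ n]) auto
  also have "\<dots> = (\<Sum>k<d. if k = s + i then (if s + i = s' + j then 1 else 0) else 0)"
    using i j by (intro sum.cong) (auto simp: incl_mat_def)
  also have "\<dots> = (if s + i = s' + j then 1 else 0)"
    using i assms by (simp add: sum.delta)
  finally show "(transpose_mat (incl_mat d s n) * incl_mat d s' n') $$ (i, j)
      = mat n n' (\<lambda>(i, j). if s + i = s' + j then 1 else 0) $$ (i, j)"
    using i j by simp
qed (auto simp: incl_mat_def)

lemma transpose_incl_mult_self:
  "s + n \<le> d \<Longrightarrow> transpose_mat (incl_mat d s n) * incl_mat d s n = 1\<^sub>m n"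
  by (subst transpose_incl_mult_incl) (auto simp: one_mat_def)

lemma transpose_incl_mult_disjoint:
  assumes "s + n \<le> d" "s' + n' \<le> s"
  shows "transpose_mat (incl_mat d s n) * incl_mat d s' n' = 0\<^sub>m n n'"
  using assms by (subst transpose_incl_mult_incl) (auto simp: zero_mat_def)

lemma incl_mult_incl:
  assumes "s + n \<le> m" "m \<le> d"
  shows "incl_mat d 0 m * incl_mat m s n = incl_mat d s n"
proof (rule eq_matI)
  fix i j assume "i < dim_row (incl_mat d s n)" "j < dim_col (incl_mat d s n)"
  then have i: "i < d" and j: "j < n" by (auto simp: incl_mat_def)
  have "(incl_mat d 0 m * incl_mat m s n) $$ (i, j)
      = (\<Sum>k<m. incl_mat d 0 m $$ (i, k) * incl_mat m s n $$ (k, j))"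
    using i j by (intro mat_mult_index[of _ d]) auto
  also have "\<dots> = (\<Sum>k<m. if k = s + j then (if i = s + j then 1 else 0) else 0)"
    using i j by (intro sum.cong) (auto simp: incl_mat_def)
  also have "\<dots> = (if i = s + j then 1 else 0)"
    using j assms by (simp add: sum.delta)
  finally show "(incl_mat d 0 m * incl_mat m s n) $$ (i, j) = incl_mat d s n $$ (i, j)"
    using i j by (simp add: incl_mat_def)
qed (auto simp: incl_mat_def)

definition dsum :: "complex mat \<Rightarrow> complex mat \<Rightarrow> complex mat" where
  "dsum A B = four_block_mat A (0\<^sub>m (dim_row A) (dim_col B)) (0\<^sub>m (dim_row B) (dim_col A)) B"

lemma dsum_carrier_mat:
  assumes "A \<in> carrier_mat m m" "B \<in> carrier_mat n n"
  shows "dsum A B \<in> carrier_mat (m + n) (m + n)"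
  using assms by (auto simp: dsum_def)

lemma dsum_mult:
  assumes "A \<in> carrier_mat m m" "B \<in> carrier_mat n n" "A' \<in> carrier_mat m m" "B' \<in> carrier_mat n n"
  shows "dsum A B * dsum A' B' = dsum (A * A') (B * B')"
  unfolding dsum_def using assms
  by (subst mult_four_block_mat[of _ m m _ n _ n]) auto

lemma dsum_one: "dsum (1\<^sub>m m) (1\<^sub>m n) = 1\<^sub>m (m + n)"
  unfolding dsum_def by (rule eq_matI) auto

lemma transpose_dsum:
  assumes "A \<in> carrier_mat m m" "B \<in> carrier_mat n n"
  shows "transpose_mat (dsum A B) = dsum (transpose_mat A) (transpose_mat B)"
  unfolding dsum_def using assms
  by (subst transpose_four_block_mat[of _ m m _ n _ n]) auto

lemma dsum_mult_incl:
  assumes A: "A \<in> carrier_mat m m" and B: "B \<in> carrier_mat n n"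
  shows "dsum A B * incl_mat (m + n) 0 m = incl_mat (m + n) 0 m * A"
    and "dsum A B * incl_mat (m + n) m n = incl_mat (m + n) m n * B"
proof -
  \<comment> \<open>Both inclusions are written as block matrices whose second block column has
    width 0, and below \<open>A\<close> and \<open>B\<close> receive empty blocks as well, so that
    block multiplication applies.\<close>
  have 1: "incl_mat (m + n) 0 m = four_block_mat (1\<^sub>m m) (0\<^sub>m m 0) (0\<^sub>m n m) (0\<^sub>m n 0)"
    and 2: "incl_mat (m + n) m n = four_block_mat (0\<^sub>m m n) (0\<^sub>m m 0) (1\<^sub>m n) (0\<^sub>m n 0)"
    by (rule eq_matI; auto simp: incl_mat_def)+
  have A': "A = four_block_mat A (0\<^sub>m m 0) (0\<^sub>m 0 m) (0\<^sub>m 0 0)"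
    using A by (intro eq_matI) auto
  have B': "B = four_block_mat B (0\<^sub>m n 0) (0\<^sub>m 0 n) (0\<^sub>m 0 0)"
    using B by (intro eq_matI) auto
  show "dsum A B * incl_mat (m + n) 0 m = incl_mat (m + n) 0 m * A"
  proof -
    have "dsum A B * incl_mat (m + n) 0 m = four_block_mat A (0\<^sub>m m 0) (0\<^sub>m n m) (0\<^sub>m n 0)"
      unfolding 1 dsum_def using A B
      by (subst mult_four_block_mat[of _ m m _ n _ n _ _ m _ 0]) auto
    also have "\<dots> = incl_mat (m + n) 0 m * four_block_mat A (0\<^sub>m m 0) (0\<^sub>m 0 m) (0\<^sub>m 0 0)"
      unfolding 1 using A B
      by (subst mult_four_block_mat[of _ m m _ 0 _ n _ _ m _ 0]) auto
    finally show ?thesis using A' by simp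
  qed
  show "dsum A B * incl_mat (m + n) m n = incl_mat (m + n) m n * B"
  proof -
    have "dsum A B * incl_mat (m + n) m n = four_block_mat (0\<^sub>m m n) (0\<^sub>m m 0) B (0\<^sub>m n 0)"
      unfolding 2 dsum_def using A B
      by (subst mult_four_block_mat[of _ m m _ n _ n _ _ n _ 0]) auto
    also have "\<dots> = incl_mat (m + n) m n * four_block_mat B (0\<^sub>m n 0) (0\<^sub>m 0 n) (0\<^sub>m 0 0)"
      unfolding 2 using A B
      by (subst mult_four_block_mat[of _ m n _ 0 _ n _ _ n _ 0]) auto
    finally show ?thesis using B' by simp
  qed
qed

lemma dsum_GL:
  assumes A: "A \<in> carrier (GL m)" and B: "B \<in> carrier (GL n)"
  shows "dsum A B \<in> carrier (GL (m + n))"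
    and "inv\<^bsub>GL (m + n)\<^esub> (dsum A B) = dsum (inv\<^bsub>GL m\<^esub> A) (inv\<^bsub>GL n\<^esub> B)"
proof -
  note * = dsum_carrier_mat[OF GL_carrier_mat GL_carrier_mat]
    dsum_carrier_mat[OF inv_GL_carrier_mat inv_GL_carrier_mat]
  note c = GL_carrier_mat[OF A] GL_carrier_mat[OF B] inv_GL_carrier_mat[OF A] inv_GL_carrier_mat[OF B]
  have "dsum (inv\<^bsub>GL m\<^esub> A) (inv\<^bsub>GL n\<^esub> B) * dsum A B = 1\<^sub>m (m + n)"
    "dsum A B * dsum (inv\<^bsub>GL m\<^esub> A) (inv\<^bsub>GL n\<^esub> B) = 1\<^sub>m (m + n)"
    using dsum_mult[OF c(3,4,1,2)] dsum_mult[OF c] by (simp_all add: inv_GL[OF A] inv_GL[OF B] dsum_one)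
  from inv_GL_eqI[OF *(1)[OF A B] *(2)[OF A B] this]
  show "dsum A B \<in> carrier (GL (m + n))"
    and "inv\<^bsub>GL (m + n)\<^esub> (dsum A B) = dsum (inv\<^bsub>GL m\<^esub> A) (inv\<^bsub>GL n\<^esub> B)" by auto
qed

lemma dsum_hom:
  assumes "\<rho> \<in> hom G (GL m)" "\<sigma> \<in> hom G (GL n)"
  shows "(\<lambda>g. dsum (\<rho> g) (\<sigma> g)) \<in> hom G (GL (m + n))"
proof (rule homI)
  fix g assume g: "g \<in> carrier G"
  then show "dsum (\<rho> g) (\<sigma> g) \<in> carrier (GL (m + n))"
    using assms by (intro dsum_GL(1)) (auto simp: hom_def)
  fix h assume h: "h \<in> carrier G"
  have "\<rho> g \<in> carrier_mat m m" "\<sigma> g \<in> carrier_mat n n" "\<rho> h \<in> carrier_mat m m" "\<sigma> h \<in> carrier_mat n n"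
    using assms g h by (auto simp: hom_def intro!: GL_carrier_mat)
  then show "dsum (\<rho> (g \<otimes>\<^bsub>G\<^esub> h)) (\<sigma> (g \<otimes>\<^bsub>G\<^esub> h))
      = dsum (\<rho> g) (\<sigma> g) \<otimes>\<^bsub>GL (m + n)\<^esub> dsum (\<rho> h) (\<sigma> h)"
    using assms g h by (simp add: hom_mult dsum_mult)
qed

text \<open>An injective intertwiner into the first summand stays one after composition with the
  inclusion of that summand.\<close>

lemma contains_rep_dsum:
  assumes c: "contains_rep G m \<rho> k \<tau>" and \<rho>: "\<rho> \<in> hom G (GL m)" and \<sigma>: "\<sigma> \<in> hom G (GL n)"
    and \<tau>: "\<tau> \<in> hom G (GL k)"
  shows "contains_rep G (m + n) (\<lambda>g. dsum (\<rho> g) (\<sigma> g)) k \<tau>"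
proof -
  let ?J = "incl_mat (m + n) 0 m"
  have J: "?J \<in> carrier_mat (m + n) m" "transpose_mat ?J \<in> carrier_mat m (m + n)" by simp_all
  from c obtain T where T: "T \<in> carrier_mat m k"
    and inj: "\<And>x. x \<in> carrier_vec k \<Longrightarrow> T *\<^sub>v x = 0\<^sub>v m \<Longrightarrow> x = 0\<^sub>v k"
    and eq: "\<And>g. g \<in> carrier G \<Longrightarrow> \<rho> g * T = T * \<tau> g"
    by (auto simp: contains_rep_def)
  show ?thesis
    unfolding contains_rep_def
  proof (intro bexI[of _ "?J * T"] conjI ballI impI)
    show "?J * T \<in> carrier_mat (m + n) k" by (rule mult_carrier_mat[OF J(1) T])
    fix x :: "complex vec" assume x: "x \<in> carrier_vec k" and 0: "?J * T *\<^sub>v x = 0\<^sub>v (m + n)"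
    \<comment> \<open>The transposed inclusion is a left inverse of the inclusion, so no vector is
      lost in the larger space.\<close>
    have "T *\<^sub>v x = (transpose_mat ?J * ?J) *\<^sub>v (T *\<^sub>v x)"
      using T x by (simp add: transpose_incl_mult_self)
    also have "\<dots> = transpose_mat ?J *\<^sub>v (?J *\<^sub>v (T *\<^sub>v x))"
      by (rule assoc_mult_mat_vec[OF J(2,1)]) (use T x in auto)
    also have "?J *\<^sub>v (T *\<^sub>v x) = 0\<^sub>v (m + n)"
      using assoc_mult_mat_vec[OF J(1) T x] 0 by simp
    also have "transpose_mat ?J *\<^sub>v 0\<^sub>v (m + n) = 0\<^sub>v m"
      by (rule eq_vecI) (auto simp: incl_mat_def scalar_prod_def)
    finally show "x = 0\<^sub>v k" using inj x by simp
  next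
    fix g assume g: "g \<in> carrier G"
    then have c: "\<rho> g \<in> carrier_mat m m" "\<sigma> g \<in> carrier_mat n n" "\<tau> g \<in> carrier_mat k k"
      using \<rho> \<sigma> \<tau> by (auto simp: hom_def intro!: GL_carrier_mat)
    have "dsum (\<rho> g) (\<sigma> g) * (?J * T) = (dsum (\<rho> g) (\<sigma> g) * ?J) * T"
      by (rule assoc_mult_mat[symmetric, OF dsum_carrier_mat[OF c(1,2)] J(1) T])
    also have "\<dots> = ?J * \<rho> g * T" by (simp add: dsum_mult_incl[OF c(1,2)])
    also have "\<dots> = ?J * (\<rho> g * T)" by (rule assoc_mult_mat[OF J(1) c(1) T])
    also have "\<dots> = ?J * T * \<tau> g"
      unfolding eq[OF g] by (rule assoc_mult_mat[symmetric, OF J(1) T c(3)])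
    finally show "dsum (\<rho> g) (\<sigma> g) * (?J * T) = ?J * T * \<tau> g" .
  qed
qed

subsection \<open>Restriction of the legs\<close>

text \<open>Restricts all four legs to one summand of the bond space. The same matrix serves on the
  primal and the dual legs because the product of a coordinate projection with its transpose is the
  identity.\<close>

definition leg_proj :: "nat \<Rightarrow> nat \<Rightarrow> nat \<Rightarrow> complex mat" where
  "leg_proj D s n = (let J = transpose_mat (incl_mat D s n) in leg_op J J J J)"

lemma leg_proj_carrier_mat [simp]: "leg_proj D s n \<in> carrier_mat (n ^ 4) (D ^ 4)"
  unfolding leg_proj_def Let_def by (intro leg_op_carrier) auto

text \<open>Bond values outside the chosen block contribute nothing, so a given state is also
  obtained with the larger bond dimension of the path.\<close>

lemma peps_state_leg_proj:
  assumes "A \<in> carrier_mat d (n ^ 4)" "s + n \<le> D" "L > 0" "M > 0"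
  shows "peps_state D d (A * leg_proj D s n) L M = peps_state n d A L M"
  unfolding leg_proj_def Let_def using assms
  by (intro peps_state_mult_leg_op) (auto simp: transpose_incl_mult_self)

lemma leg_proj_bond_op:
  assumes Y: "Y \<in> carrier (GL D)" and Z: "Z \<in> carrier (GL n)"
    and 1: "transpose_mat (incl_mat D s n) * Y = Z * transpose_mat (incl_mat D s n)"
    and 2: "transpose_mat (incl_mat D s n) * contragredient D Y
      = contragredient n Z * transpose_mat (incl_mat D s n)"
  shows "leg_proj D s n * bond_op D Y Y = bond_op n Z Z * leg_proj D s n"
proof -
  let ?J = "transpose_mat (incl_mat D s n)"
  have J: "?J \<in> carrier_mat n D" by simp
  note c = GL_carrier_mat[OF Y] contragredient_carrier_mat[OF Y]
    GL_carrier_mat[OF Z] contragredient_carrier_mat[OF Z]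
  have "leg_proj D s n * bond_op D Y Y
      = leg_op (?J * Y) (?J * Y) (?J * contragredient D Y) (?J * contragredient D Y)"
    unfolding leg_proj_def Let_def bond_op_eq_leg_op by (rule leg_op_mult[OF J J J J c(1,1,2,2)])
  also have "\<dots> = bond_op n Z Z * leg_proj D s n"
    unfolding 1 2 leg_proj_def Let_def bond_op_eq_leg_op
    by (rule leg_op_mult[symmetric, OF c(3,3,4,4) J J J J])
  finally show ?thesis .
qed

text \<open>This is \<open>dsum_mult_incl\<close> for the transposed blocks, read after
  transposition.\<close>

lemma transpose_incl_mult_dsum:
  assumes A: "A \<in> carrier_mat m m" and B: "B \<in> carrier_mat n n"
  shows "transpose_mat (incl_mat (m + n) 0 m) * dsum A B = A * transpose_mat (incl_mat (m + n) 0 m)"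
    and "transpose_mat (incl_mat (m + n) m n) * dsum A B = B * transpose_mat (incl_mat (m + n) m n)"
proof -
  have t: "transpose_mat A \<in> carrier_mat m m" "transpose_mat B \<in> carrier_mat n n"
    using A B by auto
  have e: "dsum A B = transpose_mat (dsum (transpose_mat A) (transpose_mat B))"
    by (simp add: transpose_dsum[OF t])
  show "transpose_mat (incl_mat (m + n) 0 m) * dsum A B = A * transpose_mat (incl_mat (m + n) 0 m)"
    unfolding e using dsum_mult_incl(1)[OF t] A
    by (simp flip: transpose_mult[OF dsum_carrier_mat[OF t] incl_mat_carrier])
      (simp add: transpose_mult[OF incl_mat_carrier t(1)])
  show "transpose_mat (incl_mat (m + n) m n) * dsum A B = B * transpose_mat (incl_mat (m + n) m n)"
    unfolding e using dsum_mult_incl(2)[OF t] B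
    by (simp flip: transpose_mult[OF dsum_carrier_mat[OF t] incl_mat_carrier])
      (simp add: transpose_mult[OF incl_mat_carrier t(2)])
qed

lemma leg_proj_bond_op_dsum:
  assumes A: "A \<in> carrier (GL m)" and B: "B \<in> carrier (GL n)"
  shows "leg_proj (m + n) 0 m * bond_op (m + n) (dsum A B) (dsum A B)
      = bond_op m A A * leg_proj (m + n) 0 m"
    and "leg_proj (m + n) m n * bond_op (m + n) (dsum A B) (dsum A B)
      = bond_op n B B * leg_proj (m + n) m n"
proof -
  note c = GL_carrier_mat[OF A] GL_carrier_mat[OF B]
    inv_GL_carrier_mat[OF A] inv_GL_carrier_mat[OF B]
    contragredient_carrier_mat[OF A] contragredient_carrier_mat[OF B]
  \<comment> \<open>The contragredient of a block sum is again a block sum, so the dual legs are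
    handled like the primal ones.\<close>
  have d: "contragredient (m + n) (dsum A B) = dsum (contragredient m A) (contragredient n B)"
    by (simp add: dsum_GL(2)[OF A B] transpose_dsum[OF c(3,4)])
  show "leg_proj (m + n) 0 m * bond_op (m + n) (dsum A B) (dsum A B)
      = bond_op m A A * leg_proj (m + n) 0 m"
    using transpose_incl_mult_dsum(1)[OF c(1,2)] transpose_incl_mult_dsum(1)[OF c(5,6)]
    by (intro leg_proj_bond_op dsum_GL A B) (simp_all add: d)
  show "leg_proj (m + n) m n * bond_op (m + n) (dsum A B) (dsum A B)
      = bond_op n B B * leg_proj (m + n) m n"
    using transpose_incl_mult_dsum(2)[OF c(1,2)] transpose_incl_mult_dsum(2)[OF c(5,6)]
    by (intro leg_proj_bond_op dsum_GL A B) (simp_all add: d)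
qed

subsection \<open>Averaging over the group\<close>

text \<open>For a representation \<open>w\<close> this is the projector onto the invariant vectors.
  With \<open>w\<close> the gauge action on the four legs it is the operator on the right of the
  left-inverse condition of \<open>G_injective_wrt\<close>.\<close>

definition average :: "('g, 'x) monoid_scheme \<Rightarrow> nat \<Rightarrow> ('g \<Rightarrow> complex mat) \<Rightarrow> complex mat" where
  "average G n w = (1 / of_nat (card (carrier G))) \<cdot>\<^sub>m
     (\<Oplus>\<^bsub>ring_mat TYPE(complex) n ()\<^esub> g\<in>carrier G. w g)"

lemma finsum_ring_mat_const:
  assumes "finite S" "X \<in> carrier_mat n n"
  shows "(\<Oplus>\<^bsub>ring_mat TYPE(complex) n ()\<^esub> g\<in>S. X) = of_nat (card S) \<cdot>\<^sub>m X"
proof -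
  interpret R: ring "ring_mat TYPE(complex) n ()" by (rule ring_mat)
  have X: "X \<in> carrier (ring_mat TYPE(complex) n ())"
    using assms by (simp add: ring_mat_simps)
  from assms(1) show ?thesis
  proof (induction S rule: finite_induct)
    case empty
    then show ?case using assms(2) by (auto simp: ring_mat_simps)
  next
    case (insert s S)
    then have "(\<Oplus>\<^bsub>ring_mat TYPE(complex) n ()\<^esub> g\<in>insert s S. X) = X + of_nat (card S) \<cdot>\<^sub>m X"
      using X by (simp add: ring_mat_simps)
    also have "\<dots> = of_nat (card (insert s S)) \<cdot>\<^sub>m X"
      using insert by (auto simp: algebra_simps)
    finally show ?case .
  qed
qed

context
  fixes G :: "('g, 'x) monoid_scheme" and n :: nat and w :: "'g \<Rightarrow> complex mat"
  assumes G: "group G" and fin: "finite (carrier G)" and w: "w \<in> hom G (GL n)"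
begin

interpretation G: group G by (rule G)

interpretation R: ring "ring_mat TYPE(complex) n ()"
  rewrites "mult (ring_mat TYPE(complex) n ()) = (*)"
    and "carrier (ring_mat TYPE(complex) n ()) = carrier_mat n n"
    and "add (ring_mat TYPE(complex) n ()) = (+)"
  by (rule ring_mat) (simp_all add: ring_mat_simps)

private abbreviation "S \<equiv> (\<Oplus>\<^bsub>ring_mat TYPE(complex) n ()\<^esub> g\<in>carrier G. w g)"

private lemma w_carrier: "g \<in> carrier G \<Longrightarrow> w g \<in> carrier_mat n n"
  using w by (auto simp: hom_def intro!: GL_carrier_mat)

private lemma w_mult: "g \<in> carrier G \<Longrightarrow> h \<in> carrier G \<Longrightarrow> w g * w h = w (g \<otimes>\<^bsub>G\<^esub> h)"
  using hom_mult[OF w] by simp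

private lemma S_carrier: "S \<in> carrier_mat n n"
  using R.finsum_closed[of w "carrier G"] w_carrier by auto

lemma average_carrier_mat: "average G n w \<in> carrier_mat n n"
  unfolding average_def using S_carrier by simp

text \<open>Moving \<open>c\<close> through the sum only permutes the summands. Two uses explain the
  separate \<open>c\<close> and \<open>c'\<close>: with the identity as \<open>c\<close> and a
  translation as \<open>f\<close>, the average absorbs \<open>w h\<close>; with a group automorphism
  as \<open>f\<close>, it commutes with the symmetry.\<close>

lemma mult_average:
  assumes "c \<in> carrier_mat n n" "bij_betw f (carrier G) (carrier G)"
    and cw: "\<And>g. g \<in> carrier G \<Longrightarrow> c * w g = w (f g) * c'" and c': "c' \<in> carrier_mat n n"
  shows "c * average G n w = average G n w * c'"
proof -
  have f: "f g \<in> carrier G" if "g \<in> carrier G" for g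
    using assms(2) that by (rule bij_betw_apply)
  have "c * S = (\<Oplus>\<^bsub>ring_mat TYPE(complex) n ()\<^esub> g\<in>carrier G. c * w g)"
    using fin assms(1) w_carrier by (intro R.finsum_rdistr) auto
  also have "\<dots> = (\<Oplus>\<^bsub>ring_mat TYPE(complex) n ()\<^esub> g\<in>carrier G. w (f g) * c')"
    using assms(1) by (intro R.finsum_cong') (auto simp: cw[symmetric] w_carrier)
  also have "\<dots> = (\<Oplus>\<^bsub>ring_mat TYPE(complex) n ()\<^esub> g\<in>carrier G. w (f g)) * c'"
    using fin c' w_carrier f by (intro R.finsum_ldistr[symmetric]) auto
  also have "(\<Oplus>\<^bsub>ring_mat TYPE(complex) n ()\<^esub> g\<in>carrier G. w (f g)) = S"
    using R.finsum_reindex[of w f "carrier G"] assms(2) w_carrier by (auto simp: bij_betw_def)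
  finally have "c * S = S * c'" .
  then show ?thesis
    unfolding average_def using S_carrier assms(1) c'
    by (simp add: mult_smult_distrib[of _ n n _ n] mult_smult_assoc_mat[of _ n n _ n])
qed

lemma average_absorb_right:
  assumes h: "h \<in> carrier G"
  shows "average G n w * w h = average G n w"
proof -
  have "bij_betw (\<lambda>g. g \<otimes>\<^bsub>G\<^esub> inv\<^bsub>G\<^esub> h) (carrier G) (carrier G)"
    by (rule bij_betwI[where g = "\<lambda>g. g \<otimes>\<^bsub>G\<^esub> h"]) (use h in \<open>auto simp: G.m_assoc\<close>)
  from mult_average[OF one_carrier_mat this _ w_carrier[OF h]] show ?thesis
    using h left_mult_one_mat[OF w_carrier] left_mult_one_mat[OF average_carrier_mat]
    by (simp add: w_mult G.m_assoc)
qed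

lemma average_idem: "average G n w * average G n w = average G n w"
proof -
  let ?P = "average G n w"
  have "?P * S = (\<Oplus>\<^bsub>ring_mat TYPE(complex) n ()\<^esub> g\<in>carrier G. ?P * w g)"
    using fin average_carrier_mat w_carrier by (intro R.finsum_rdistr) auto
  also have "\<dots> = (\<Oplus>\<^bsub>ring_mat TYPE(complex) n ()\<^esub> g\<in>carrier G. ?P)"
    using average_carrier_mat by (intro R.finsum_cong') (auto simp: average_absorb_right)
  also have "\<dots> = of_nat (card (carrier G)) \<cdot>\<^sub>m ?P"
    by (rule finsum_ring_mat_const[OF fin average_carrier_mat])
  finally have "?P * S = of_nat (card (carrier G)) \<cdot>\<^sub>m ?P" .
  then have "?P * ?P = (1 / of_nat (card (carrier G))) \<cdot>\<^sub>m (of_nat (card (carrier G)) \<cdot>\<^sub>m ?P)"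
    using mult_smult_distrib[OF average_carrier_mat S_carrier] by (simp add: average_def)
  also have "\<dots> = ?P"
    \<comment> \<open>The scalars cancel because the order of a finite group is nonzero.\<close>
    using fin G.order_gt_0_iff_finite by (intro eq_matI) (auto simp: order_def)
  finally show ?thesis .
qed

text \<open>The projective factors \<open>w (\<omega> k q)\<close> act trivially on the image of the average, where \<open>c\<close>
  therefore restricts to a representation; \<open>R\<close> is this restriction plus the identity on the kernel.\<close>

lemma average_twisted_hom:
  fixes Q :: "('q, 'y) monoid_scheme"
  assumes Q: "group Q" and c: "\<And>q. q \<in> carrier Q \<Longrightarrow> c q \<in> carrier (GL n)"
    and comm: "\<And>q. q \<in> carrier Q \<Longrightarrow> c q * average G n w = average G n w * c q"
    and \<omega>: "\<And>k q. k \<in> carrier Q \<Longrightarrow> q \<in> carrier Q \<Longrightarrow> \<omega> k q \<in> carrier G"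
    and cc: "\<And>k q. k \<in> carrier Q \<Longrightarrow> q \<in> carrier Q \<Longrightarrow> c k * c q = w (\<omega> k q) * c (k \<otimes>\<^bsub>Q\<^esub> q)"
  shows "\<exists>R\<in>hom Q (GL n). \<forall>q\<in>carrier Q. R q * average G n w = average G n w * c q"
proof -
  interpret Q: group Q by (rule Q)
  define P where "P = average G n w"
  define Z where "Z = 1\<^sub>m n - P"
  have P: "P \<in> carrier_mat n n" unfolding P_def by (rule average_carrier_mat)
  have Z: "Z \<in> carrier_mat n n" unfolding Z_def by (rule minus_carrier_mat[OF P])
  have PP: "P * P = P" unfolding P_def by (rule average_idem)
  have PZ: "P * Z = 0\<^sub>m n n" and ZP: "Z * P = 0\<^sub>m n n"
    unfolding Z_def using P
    by (simp_all add: mult_minus_distrib_mat[of _ n n _ n] minus_mult_distrib_mat[of _ n n _ _ n] PP)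
  have ZZ: "Z * Z = Z"
  proof -
    have "Z * Z = (1\<^sub>m n - P) * Z" by (simp add: Z_def)
    also have "\<dots> = 1\<^sub>m n * Z - P * Z" using P Z by (intro minus_mult_distrib_mat) auto
    also have "\<dots> = Z" unfolding PZ using Z by (intro eq_matI) auto
    finally show ?thesis .
  qed
  have PpZ: "P + Z = 1\<^sub>m n" unfolding Z_def using P by (intro eq_matI) auto
  have c': "c q \<in> carrier_mat n n" if "q \<in> carrier Q" for q
    by (rule GL_carrier_mat[OF c[OF that]])
  have cP: "c q * P = P * c q" if "q \<in> carrier Q" for q
    unfolding P_def by (rule comm[OF that])
  have wP: "P * w h = P" if "h \<in> carrier G" for h
    unfolding P_def by (rule average_absorb_right[OF that])
  define R where "R q = P * c q + Z" for q
  have R: "R q \<in> carrier_mat n n" if "q \<in> carrier Q" for q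
    unfolding R_def using P Z c'[OF that] by simp
  have mult: "R k * R q = R (k \<otimes>\<^bsub>Q\<^esub> q)" if k: "k \<in> carrier Q" and q: "q \<in> carrier Q" for k q
  proof -
    note kq = c'[OF k] c'[OF q] c'[OF Q.m_closed[OF k q]] w_carrier[OF \<omega>[OF k q]]
    \<comment> \<open>Commuting \<open>P\<close> past \<open>c k\<close> brings it next to the twist
      \<open>w (\<omega> k q)\<close>, which it absorbs.\<close>
    have 1: "(P * c k) * (P * c q) = P * c (k \<otimes>\<^bsub>Q\<^esub> q)"
    proof -
      have "(P * c k) * (P * c q) = P * ((c k * P) * c q)"
        using P kq by (simp add: R.m_assoc)
      also have "\<dots> = (P * P) * (c k * c q)"
        unfolding cP[OF k] using P kq by (simp add: R.m_assoc)
      also have "\<dots> = (P * w (\<omega> k q)) * c (k \<otimes>\<^bsub>Q\<^esub> q)"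
        unfolding PP cc[OF k q] using P kq by (simp add: R.m_assoc)
      finally show ?thesis by (simp add: wP \<omega> k q)
    qed
    have 2: "(P * c k) * Z = 0\<^sub>m n n"
    proof -
      have "(P * c k) * Z = c k * (P * Z)"
        unfolding cP[OF k, symmetric] using P Z kq by (simp add: R.m_assoc)
      then show ?thesis using kq by (simp add: PZ)
    qed
    have 3: "Z * (P * c q) = 0\<^sub>m n n"
      using R.m_assoc[OF Z P kq(2)] kq by (simp add: ZP)
    show ?thesis
      unfolding R_def using P Z kq by (simp add: R.l_distr R.r_distr 1 2 3 ZZ)
  qed
  \<comment> \<open>Cancelling one \<open>c \<one>\<close> in
    \<open>c \<one> * c \<one> = w (\<omega> \<one> \<one>) * c \<one>\<close> shows that
    \<open>c\<close> at the identity is itself a twist, which \<open>P\<close> absorbs.\<close>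
  have one: "R \<one>\<^bsub>Q\<^esub> = 1\<^sub>m n"
  proof -
    interpret GL: group "GL n" by (rule group_GL)
    note c1 = c[OF Q.one_closed]
    have "w (\<omega> \<one>\<^bsub>Q\<^esub> \<one>\<^bsub>Q\<^esub>) \<in> carrier (GL n)"
      using w \<omega> by (auto simp: hom_def)
    then have "c \<one>\<^bsub>Q\<^esub> = w (\<omega> \<one>\<^bsub>Q\<^esub> \<one>\<^bsub>Q\<^esub>)"
      using GL.right_cancel[of "c \<one>\<^bsub>Q\<^esub>" "c \<one>\<^bsub>Q\<^esub>" "w (\<omega> \<one>\<^bsub>Q\<^esub> \<one>\<^bsub>Q\<^esub>)"]
        c1 cc[of "\<one>\<^bsub>Q\<^esub>" "\<one>\<^bsub>Q\<^esub>"] by simp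
    then show ?thesis by (simp add: R_def wP \<omega> PpZ)
  qed
  have "R \<in> hom Q (GL n)"
  proof (rule homI)
    fix q assume q: "q \<in> carrier Q"
    show "R q \<in> carrier (GL n)"
      using R[OF q] R[OF Q.inv_closed[OF q]] mult[OF q Q.inv_closed[OF q]]
        mult[OF Q.inv_closed[OF q] q] by (intro inv_GL_eqI(1)) (simp_all add: q one)
  qed (simp add: mult)
  moreover have "R q * P = P * c q" if q: "q \<in> carrier Q" for q
  proof -
    have "R q * P = P * (c q * P) + Z * P"
      unfolding R_def using P Z c'[OF q] by (simp add: R.l_distr R.m_assoc)
    also have "\<dots> = (P * P) * c q + Z * P"
      unfolding cP[OF q] using P c'[OF q] by (simp add: R.m_assoc)
    finally show ?thesis using P c'[OF q] by (simp add: PP ZP)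
  qed
  ultimately show ?thesis unfolding P_def by blast
qed

end

subsection \<open>Changing the representative of the class\<close>

text \<open>Since \<open>A\<close> absorbs \<open>u g\<close> on its legs, a left factor
  \<open>u g\<close> on \<open>v q\<close> preserves the symmetry equation, while it changes \<phi>
  and \<omega> exactly as \<open>same_class\<close> allows.\<close>

lemma symmetric_peps_regauge:
  assumes G: "group G" and Q: "group Q"
    and sym: "symmetric_peps G Q D d A u U v \<phi>' \<omega>'"
    and cls: "same_class G Q \<phi> \<omega> \<phi>' \<omega>'"
    and \<phi>: "\<And>q. q \<in> carrier Q \<Longrightarrow> \<phi> q \<in> iso G G"
    and \<omega>: "\<And>k q. k \<in> carrier Q \<Longrightarrow> q \<in> carrier Q \<Longrightarrow> \<omega> k q \<in> carrier G"
  shows "\<exists>v'. symmetric_peps G Q D d A u U v' \<phi> \<omega>"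
proof -
  interpret G: group G by (rule G)
  interpret Q: group Q by (rule Q)
  interpret GL: group "GL D"
    rewrites "mult (GL D) = (*)" and "one (GL D) = 1\<^sub>m D"
    by (rule group_GL) (simp_all add: fun_eq_iff)
  from cls obtain \<gamma> where \<gamma>: "\<And>k. k \<in> carrier Q \<Longrightarrow> \<gamma> k \<in> carrier G"
    and \<phi>': "\<And>k h. k \<in> carrier Q \<Longrightarrow> h \<in> carrier G \<Longrightarrow>
      \<phi>' k h = \<gamma> k \<otimes>\<^bsub>G\<^esub> \<phi> k h \<otimes>\<^bsub>G\<^esub> inv\<^bsub>G\<^esub> \<gamma> k"
    and \<omega>': "\<And>k q. k \<in> carrier Q \<Longrightarrow> q \<in> carrier Q \<Longrightarrow>
      \<omega>' k q = \<gamma> k \<otimes>\<^bsub>G\<^esub> \<phi> k (\<gamma> q) \<otimes>\<^bsub>G\<^esub> \<omega> k q \<otimes>\<^bsub>G\<^esub> inv\<^bsub>G\<^esub> \<gamma> (k \<otimes>\<^bsub>Q\<^esub> q)"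
    unfolding same_class_def by blast
  from sym have inj: "G_injective_wrt G D d A u" and U: "U \<in> hom Q (GL d)"
    and v: "\<And>q. q \<in> carrier Q \<Longrightarrow> v q \<in> carrier (GL D)"
    and UA: "\<And>q. q \<in> carrier Q \<Longrightarrow> U q * A = A * bond_op D (v q) (v q)"
    and vu: "\<And>q g. q \<in> carrier Q \<Longrightarrow> g \<in> carrier G \<Longrightarrow> v q * u g * inv\<^bsub>GL D\<^esub> (v q) = u (\<phi>' q g)"
    and vv: "\<And>k q. k \<in> carrier Q \<Longrightarrow> q \<in> carrier Q \<Longrightarrow> v k * v q = u (\<omega>' k q) * v (k \<otimes>\<^bsub>Q\<^esub> q)"
    and \<phi>'G: "\<And>q. q \<in> carrier Q \<Longrightarrow> \<phi>' q \<in> iso G G"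
    and \<omega>'G: "\<And>k q. k \<in> carrier Q \<Longrightarrow> q \<in> carrier Q \<Longrightarrow> \<omega>' k q \<in> carrier G"
    unfolding symmetric_peps_def by auto
  from inj have A: "A \<in> carrier_mat d (D ^ 4)" and u: "u \<in> hom G (GL D)"
    and Au: "\<And>g. g \<in> carrier G \<Longrightarrow> A * bond_op D (u g) (u g) = A"
    unfolding G_injective_wrt_def by auto
  have uc: "u g \<in> carrier (GL D)" if "g \<in> carrier G" for g
    using u that by (auto simp: hom_def)
  have um: "u g * u h = u (g \<otimes>\<^bsub>G\<^esub> h)" if "g \<in> carrier G" "h \<in> carrier G" for g h
    using hom_mult[OF u that] by simp
  have ui: "inv\<^bsub>GL D\<^esub> (u g) = u (inv\<^bsub>G\<^esub> g)" if "g \<in> carrier G" for g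
  proof -
    interpret u: group_hom G "GL D" u
      by (intro group_hom.intro group_hom_axioms.intro G group_GL u)
    show ?thesis using that by simp
  qed
  have canc: "x \<otimes>\<^bsub>G\<^esub> (inv\<^bsub>G\<^esub> x \<otimes>\<^bsub>G\<^esub> y) = y" "inv\<^bsub>G\<^esub> x \<otimes>\<^bsub>G\<^esub> (x \<otimes>\<^bsub>G\<^esub> y) = y"
    if "x \<in> carrier G" "y \<in> carrier G" for x y
    using that by (simp_all add: G.m_assoc[symmetric])
  have \<phi>G: "\<phi> q g \<in> carrier G" if "q \<in> carrier Q" "g \<in> carrier G" for q g
    using \<phi>[OF that(1)] that(2) by (auto simp: iso_def hom_def)
  have \<phi>inv: "\<phi> q (inv\<^bsub>G\<^esub> g) = inv\<^bsub>G\<^esub> \<phi> q g" if "q \<in> carrier Q" "g \<in> carrier G" for q g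
  proof -
    interpret p: group_hom G G "\<phi> q"
      using \<phi>[OF that(1)] by (intro group_hom.intro group_hom_axioms.intro G) (simp add: iso_def)
    show ?thesis using that by simp
  qed
  \<comment> \<open>The inverse of \<gamma> appears because the passage from the unprimed to the
    primed maps has to be undone.\<close>
  define a where "a q = inv\<^bsub>G\<^esub> \<gamma> q" for q
  have a: "a q \<in> carrier G" if "q \<in> carrier Q" for q
    unfolding a_def using \<gamma>[OF that] by simp
  define v' where "v' q = u (a q) * v q" for q
  have v': "v' q \<in> carrier (GL D)" if "q \<in> carrier Q" for q
    unfolding v'_def using GL.m_closed uc a v that by blast
  have "U q * A = A * bond_op D (v' q) (v' q)" if q: "q \<in> carrier Q" for q
  proof -
    note ua = uc[OF a[OF q]]
    have "A * bond_op D (v' q) (v' q)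
        = A * (bond_op D (u (a q)) (u (a q)) * bond_op D (v q) (v q))"
      unfolding v'_def by (simp add: bond_op_mult ua v q)
    also have "\<dots> = A * bond_op D (u (a q)) (u (a q)) * bond_op D (v q) (v q)"
      by (rule assoc_mult_mat[symmetric, OF A bond_op_carrier_mat[OF ua ua]
            bond_op_carrier_mat[OF v[OF q] v[OF q]]])
    finally show ?thesis by (simp add: Au a q UA)
  qed
  moreover have "v' q * u g * inv\<^bsub>GL D\<^esub> (v' q) = u (\<phi> q g)"
    if q: "q \<in> carrier Q" and g: "g \<in> carrier G" for q g
  proof -
    note c = uc[OF a[OF q]] v[OF q] uc[OF g]
    have "v' q * u g * inv\<^bsub>GL D\<^esub> (v' q)
        = u (a q) * (v q * u g * inv\<^bsub>GL D\<^esub> (v q)) * inv\<^bsub>GL D\<^esub> (u (a q))"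
      unfolding v'_def using c by (simp add: GL.inv_mult_group GL.m_assoc)
    also have "\<dots> = u (a q \<otimes>\<^bsub>G\<^esub> \<phi>' q g \<otimes>\<^bsub>G\<^esub> \<gamma> q)"
      using q g a \<gamma> \<phi>G by (simp add: vu ui um \<phi>') (simp add: a_def)
    also have "a q \<otimes>\<^bsub>G\<^esub> \<phi>' q g \<otimes>\<^bsub>G\<^esub> \<gamma> q = \<phi> q g"
      using q g \<gamma> \<phi>G by (simp add: a_def \<phi>' G.m_assoc canc)
    finally show ?thesis .
  qed
  moreover have "v' k * v' q = u (\<omega> k q) * v' (k \<otimes>\<^bsub>Q\<^esub> q)"
    if k: "k \<in> carrier Q" and q: "q \<in> carrier Q" for k q
  proof -
    note kq = Q.m_closed[OF k q]
    have f: "\<phi>' k (a q) \<in> carrier G"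
      using \<phi>'G[OF k] a[OF q] by (auto simp: iso_def hom_def)
    note c = uc[OF a[OF q]] v[OF q] uc[OF a[OF k]] v[OF k] uc[OF f] v[OF kq] uc[OF \<omega>'G[OF k q]]
      uc[OF \<omega>[OF k q]] uc[OF a[OF kq]]
    \<comment> \<open>Moving \<open>u (a q)\<close> to the left past \<open>v k\<close> applies
      \<phi>' to its argument.\<close>
    have "v k * u (a q) = u (\<phi>' k (a q)) * v k"
      unfolding vu[OF k a[OF q], symmetric] using c by (simp add: GL.m_assoc)
    then have "v' k * v' q = u (a k) * (u (\<phi>' k (a q)) * v k) * v q"
      unfolding v'_def using c by (metis GL.m_assoc GL.m_closed)
    also have "\<dots> = u (a k) * u (\<phi>' k (a q)) * (v k * v q)"
      using c by (simp add: GL.m_assoc)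
    also have "\<dots> = u (a k) * u (\<phi>' k (a q)) * u (\<omega>' k q) * v (k \<otimes>\<^bsub>Q\<^esub> q)"
      unfolding vv[OF k q] using c by (simp add: GL.m_assoc)
    also have "u (a k) * u (\<phi>' k (a q)) * u (\<omega>' k q) = u (a k \<otimes>\<^bsub>G\<^esub> \<phi>' k (a q) \<otimes>\<^bsub>G\<^esub> \<omega>' k q)"
      using a[OF k] f \<omega>'G[OF k q] by (simp add: um)
    \<comment> \<open>After substitution \<open>a k\<close> cancels the first \<gamma> k, the inner
      conjugating factors cancel each other, and so do \<phi> k (\<gamma> q) and its
      inverse.\<close>
    also have "a k \<otimes>\<^bsub>G\<^esub> \<phi>' k (a q) \<otimes>\<^bsub>G\<^esub> \<omega>' k q = \<omega> k q \<otimes>\<^bsub>G\<^esub> a (k \<otimes>\<^bsub>Q\<^esub> q)"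
      unfolding \<phi>'[OF k a[OF q]] \<omega>'[OF k q] unfolding a_def \<phi>inv[OF k \<gamma>[OF q]]
      using \<gamma>[OF k] \<gamma>[OF q] \<gamma>[OF kq] \<phi>G[OF k \<gamma>[OF q]] \<omega>[OF k q] by (simp add: G.m_assoc canc)
    also have "u (\<omega> k q \<otimes>\<^bsub>G\<^esub> a (k \<otimes>\<^bsub>Q\<^esub> q)) * v (k \<otimes>\<^bsub>Q\<^esub> q) = u (\<omega> k q) * v' (k \<otimes>\<^bsub>Q\<^esub> q)"
      unfolding v'_def um[OF \<omega>[OF k q] a[OF kq], symmetric] using c by (simp add: GL.m_assoc)
    finally show ?thesis .
  qed
  ultimately have "symmetric_peps G Q D d A u U v' \<phi> \<omega>"
    unfolding symmetric_peps_def using inj U v' \<phi> \<omega> by simp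
  then show ?thesis by blast
qed


subsection \<open>The path\<close>

lemma mult_lincomb3:
  fixes X :: "complex mat"
  assumes "X \<in> carrier_mat m n" "K \<in> carrier_mat n p" "K' \<in> carrier_mat n p" "K'' \<in> carrier_mat n p"
  shows "X * (a \<cdot>\<^sub>m K + b \<cdot>\<^sub>m K' + c \<cdot>\<^sub>m K'') = a \<cdot>\<^sub>m (X * K) + b \<cdot>\<^sub>m (X * K') + c \<cdot>\<^sub>m (X * K'')"
  using assms
  by (simp add: mult_add_distrib_mat[of _ m n _ p] mult_smult_distrib[of _ m n _ p])

lemma lincomb3_mult:
  fixes X :: "complex mat"
  assumes "X \<in> carrier_mat n p" "K \<in> carrier_mat m n" "K' \<in> carrier_mat m n" "K'' \<in> carrier_mat m n"
  shows "(a \<cdot>\<^sub>m K + b \<cdot>\<^sub>m K' + c \<cdot>\<^sub>m K'') * X = a \<cdot>\<^sub>m (K * X) + b \<cdot>\<^sub>m (K' * X) + c \<cdot>\<^sub>m (K'' * X)"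
  using assms
  by (simp add: add_mult_distrib_mat[of _ m n _ _ p] mult_smult_assoc_mat[of _ m n _ p])

text \<open>The on-site operator is moved into the tensor, exchanged there for a gauge
  transformation of the legs, and cancels along the bonds.\<close>

lemma onsite_peps_state_symmetric:
  assumes "A \<in> carrier_mat d (D ^ 4)" "U \<in> carrier_mat d d" "v \<in> carrier (GL D)"
    and "U * A = A * bond_op D v v" "L > 0" "M > 0"
  shows "onsite U L M (peps_state D d A L M) = peps_state D d A L M"
  using assms by (simp flip: peps_state_mult_physical add: peps_state_mult_bond_op)

lemma intertwine_mult:
  assumes "X \<in> carrier_mat l l" "K \<in> carrier_mat l m" "K' \<in> carrier_mat m n"
    "Y \<in> carrier_mat m m" "Z \<in> carrier_mat n n"
    and "X * K = K * Y" "Y * K' = K' * Z"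
  shows "X * (K * K') = (K * K') * (Z :: complex mat)"
proof -
  have "X * (K * K') = (X * K) * K'" using assms by (intro assoc_mult_mat[symmetric]) auto
  also have "\<dots> = K * (Y * K')" unfolding assms(6) using assms by (intro assoc_mult_mat) auto
  also have "\<dots> = (K * K') * Z" unfolding assms(7) using assms by (intro assoc_mult_mat[symmetric]) auto
  finally show ?thesis .
qed

lemma symmetric_path_exists:
  fixes G :: "('g, 'x) monoid_scheme" and Q :: "('q, 'y) monoid_scheme"
  assumes G: "group G" and finG: "finite (carrier G)" and Q: "group Q"
    and sym0: "symmetric_peps G Q D0 d0 A0 u0 U0 v0 \<phi> \<omega>"
    and sym1: "symmetric_peps G Q D1 d1 A1 u1 U1 v1 \<phi> \<omega>"
  shows "\<exists>D d A U. symmetric_path G Q D0 d0 A0 U0 D1 d1 A1 U1 D d A U"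
proof -
  interpret G: group G by (rule G)
  from sym0 have inj0: "G_injective_wrt G D0 d0 A0 u0" and U0: "U0 \<in> hom Q (GL d0)"
    and v0: "\<And>q. q \<in> carrier Q \<Longrightarrow> v0 q \<in> carrier (GL D0)"
    and UA0: "\<And>q. q \<in> carrier Q \<Longrightarrow> U0 q * A0 = A0 * bond_op D0 (v0 q) (v0 q)"
    and \<phi>: "\<And>q. q \<in> carrier Q \<Longrightarrow> \<phi> q \<in> iso G G"
    and \<omega>: "\<And>k q. k \<in> carrier Q \<Longrightarrow> q \<in> carrier Q \<Longrightarrow> \<omega> k q \<in> carrier G"
    and vu0: "\<And>q g. q \<in> carrier Q \<Longrightarrow> g \<in> carrier G \<Longrightarrow>
      v0 q * u0 g * inv\<^bsub>GL D0\<^esub> (v0 q) = u0 (\<phi> q g)"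
    and vv0: "\<And>k q. k \<in> carrier Q \<Longrightarrow> q \<in> carrier Q \<Longrightarrow>
      v0 k * v0 q = u0 (\<omega> k q) * v0 (k \<otimes>\<^bsub>Q\<^esub> q)"
    unfolding symmetric_peps_def by auto
  from sym1 have inj1: "G_injective_wrt G D1 d1 A1 u1" and U1: "U1 \<in> hom Q (GL d1)"
    and v1: "\<And>q. q \<in> carrier Q \<Longrightarrow> v1 q \<in> carrier (GL D1)"
    and UA1: "\<And>q. q \<in> carrier Q \<Longrightarrow> U1 q * A1 = A1 * bond_op D1 (v1 q) (v1 q)"
    and vu1: "\<And>q g. q \<in> carrier Q \<Longrightarrow> g \<in> carrier G \<Longrightarrow>
      v1 q * u1 g * inv\<^bsub>GL D1\<^esub> (v1 q) = u1 (\<phi> q g)"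
    and vv1: "\<And>k q. k \<in> carrier Q \<Longrightarrow> q \<in> carrier Q \<Longrightarrow>
      v1 k * v1 q = u1 (\<omega> k q) * v1 (k \<otimes>\<^bsub>Q\<^esub> q)"
    unfolding symmetric_peps_def by auto
  from inj0 have A0: "A0 \<in> carrier_mat d0 (D0 ^ 4)" and u0: "u0 \<in> hom G (GL D0)"
    and irr0: "\<And>n \<rho>. irreducible_rep G n \<rho> \<Longrightarrow> contains_rep G D0 u0 n \<rho>"
    and Au0: "\<And>g. g \<in> carrier G \<Longrightarrow> A0 * bond_op D0 (u0 g) (u0 g) = A0"
    unfolding G_injective_wrt_def by auto
  from inj1 have A1: "A1 \<in> carrier_mat d1 (D1 ^ 4)" and u1: "u1 \<in> hom G (GL D1)"
    and Au1: "\<And>g. g \<in> carrier G \<Longrightarrow> A1 * bond_op D1 (u1 g) (u1 g) = A1"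
    unfolding G_injective_wrt_def by auto

  \<comment> \<open>The combined bond space, the gauge actions on its legs, and the projector
    \<open>P\<close>\<close>
  define D where "D = D0 + D1"
  define N where "N = D ^ 4"
  define d where "d = d0 + d1 + N"
  define u where "u g = dsum (u0 g) (u1 g)" for g
  define v where "v q = dsum (v0 q) (v1 q)" for q
  define w where "w g = bond_op D (u g) (u g)" for g
  define c where "c q = bond_op D (v q) (v q)" for q
  define P where "P = average G N w"

  have u: "u \<in> hom G (GL D)"
    unfolding u_def D_def by (rule dsum_hom[OF u0 u1])
  have uc: "u0 g \<in> carrier (GL D0)" "u1 g \<in> carrier (GL D1)" "u g \<in> carrier (GL D)"
    if "g \<in> carrier G" for g
    using u0 u1 u that by (auto simp: hom_def)
  have v: "v q \<in> carrier (GL D)" if "q \<in> carrier Q" for q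
    unfolding v_def D_def by (rule dsum_GL(1)[OF v0[OF that] v1[OF that]])
  have w: "w \<in> hom G (GL N)"
    using hom_compose[OF u bond_op_hom] by (simp add: w_def [abs_def] N_def o_def)
  have c: "c q \<in> carrier (GL N)" if "q \<in> carrier Q" for q
    using bond_op_hom[of D] v[OF that] by (simp add: c_def N_def hom_def Pi_iff)
  note w' = GL_carrier_mat[OF hom_in_carrier[OF w]] and c' = GL_carrier_mat[OF c]
  note P = average_carrier_mat[OF G finG w, folded P_def]
  have vu: "v q * u g = u (\<phi> q g) * v q" if q: "q \<in> carrier Q" and g: "g \<in> carrier G" for q g
  proof -
    \<comment> \<open>The conjugation relation is rewritten as a commutation relation without
      inverses, which passes to the direct sum block by block.\<close>
    have *: "x * y = z * x" if x: "x \<in> carrier (GL n)" and y: "y \<in> carrier (GL n)"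
      and z: "x * y * inv\<^bsub>GL n\<^esub> x = z" for x y z :: "complex mat" and n
    proof -
      note xy = mult_carrier_mat[OF GL_carrier_mat[OF x] GL_carrier_mat[OF y]]
      have "z * x = x * y * (inv\<^bsub>GL n\<^esub> x * x)"
        unfolding z[symmetric] by (rule assoc_mult_mat[OF xy inv_GL_carrier_mat[OF x] GL_carrier_mat[OF x]])
      then show ?thesis by (simp add: inv_GL(1)[OF x] right_mult_one_mat[OF xy])
    qed
    have "\<phi> q g \<in> carrier G" using \<phi>[OF q] g by (auto simp: iso_def hom_def)
    note m = uc(1,2)[OF g] v0[OF q] v1[OF q] uc(1,2)[OF this]
    show ?thesis
      unfolding v_def u_def
      using *[OF m(3,1) vu0[OF q g]] *[OF m(4,2) vu1[OF q g]]
      by (simp add: dsum_mult[OF m(3,4,1,2)[THEN GL_carrier_mat]]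
          dsum_mult[OF m(5,6,3,4)[THEN GL_carrier_mat]])
  qed
  have vv: "v k * v q = u (\<omega> k q) * v (k \<otimes>\<^bsub>Q\<^esub> q)"
    if k: "k \<in> carrier Q" and q: "q \<in> carrier Q" for k q
  proof -
    have kq: "k \<otimes>\<^bsub>Q\<^esub> q \<in> carrier Q" using Q k q by (simp add: group.is_monoid monoid.m_closed)
    note m = v0[OF k] v1[OF k] v0[OF q] v1[OF q] uc(1,2)[OF \<omega>[OF k q]] v0[OF kq] v1[OF kq]
    show ?thesis
      unfolding v_def u_def dsum_mult[OF m(1-4)[THEN GL_carrier_mat]]
        dsum_mult[OF m(5-8)[THEN GL_carrier_mat]] vv0[OF k q] vv1[OF k q] ..
  qed
  have cw: "c q * w g = w (\<phi> q g) * c q" if q: "q \<in> carrier Q" and g: "g \<in> carrier G" for q g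
  proof -
    have "\<phi> q g \<in> carrier G" using \<phi>[OF q] g by (auto simp: iso_def hom_def)
    then show ?thesis
      unfolding c_def w_def by (simp add: bond_op_mult v q uc g vu)
  qed
  have cc: "c k * c q = w (\<omega> k q) * c (k \<otimes>\<^bsub>Q\<^esub> q)"
    if k: "k \<in> carrier Q" and q: "q \<in> carrier Q" for k q
  proof -
    have kq: "k \<otimes>\<^bsub>Q\<^esub> q \<in> carrier Q" using Q k q by (simp add: group.is_monoid monoid.m_closed)
    show ?thesis
      unfolding c_def w_def by (simp add: bond_op_mult v q k kq uc \<omega> vv)
  qed
  have cP: "c q * P = P * c q" if q: "q \<in> carrier Q" for q
    \<comment> \<open>Conjugation by \<open>c q\<close> permutes the summands of the average through
      the automorphism \<phi> q.\<close>
    unfolding P_def using \<phi>[OF q] c'[OF q]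
    by (intro mult_average[OF G finG w, where f = "\<phi> q"] cw q) (auto simp: iso_def)
  obtain R where R: "R \<in> hom Q (GL N)"
    and RP: "\<And>q. q \<in> carrier Q \<Longrightarrow> R q * P = P * c q"
    using average_twisted_hom[OF G finG w Q c cP[unfolded P_def] \<omega> cc, folded P_def] by blast
  have Pw: "P * w g = P" if "g \<in> carrier G" for g
    unfolding P_def by (rule average_absorb_right[OF G finG w that])

  \<comment> \<open>The physical space, its representation, and the three summands of the
    tensor\<close>
  define U where "U q = dsum (dsum (U0 q) (U1 q)) (R q)" for q
  define i0 where "i0 = incl_mat d 0 d0"
  define i1 where "i1 = incl_mat d d0 d1"
  define i2 where "i2 = incl_mat d (d0 + d1) N"
  define E0 where "E0 = leg_proj D 0 D0"
  define E1 where "E1 = leg_proj D D0 D1"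
  \<comment> \<open>\<open>K0\<close> and \<open>K1\<close> are the given tensors with legs
    restricted to one bond block and output placed in one physical block; \<open>K2\<close> puts
    \<open>P\<close> into the third block, where \<open>R\<close> acts.\<close>
  define K0 where "K0 = i0 * (A0 * E0)"
  define K1 where "K1 = i1 * (A1 * E1)"
  define K2 where "K2 = i2 * P"

  have U: "U \<in> hom Q (GL d)"
    unfolding U_def d_def by (intro dsum_hom U0 U1 R)
  note Uc = hom_in_carrier[OF U0, THEN GL_carrier_mat] hom_in_carrier[OF U1, THEN GL_carrier_mat]
    hom_in_carrier[OF R, THEN GL_carrier_mat] hom_in_carrier[OF U, THEN GL_carrier_mat]
  have i: "i0 \<in> carrier_mat d d0" "i1 \<in> carrier_mat d d1" "i2 \<in> carrier_mat d N"
    unfolding i0_def i1_def i2_def by simp_all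
  have E: "E0 \<in> carrier_mat (D0 ^ 4) N" "E1 \<in> carrier_mat (D1 ^ 4) N"
    unfolding E0_def E1_def N_def by simp_all
  note AE = mult_carrier_mat[OF A0 E(1)] mult_carrier_mat[OF A1 E(2)]
  have K: "K0 \<in> carrier_mat d N" "K1 \<in> carrier_mat d N" "K2 \<in> carrier_mat d N"
    unfolding K0_def K1_def K2_def
    by (fact mult_carrier_mat[OF i(1) AE(1)] mult_carrier_mat[OF i(2) AE(2)] mult_carrier_mat[OF i(3) P])+

  have Ui: "U q * i0 = i0 * U0 q" "U q * i1 = i1 * U1 q" "U q * i2 = i2 * R q"
    if q: "q \<in> carrier Q" for q
  proof -
    note Uq = Uc(1-3)[OF q]
    note ds = dsum_carrier_mat[OF Uq(1,2)]
    \<comment> \<open>The inclusions are factored through the first two physical blocks because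
      \<open>U\<close> is a nested direct sum.\<close>
    have e: "i0 = incl_mat d 0 (d0 + d1) * incl_mat (d0 + d1) 0 d0"
      "i1 = incl_mat d 0 (d0 + d1) * incl_mat (d0 + d1) d0 d1"
      unfolding i0_def i1_def by (simp_all add: incl_mult_incl d_def)
    have c: "U q \<in> carrier_mat d d" by (rule Uc(4)[OF q])
    have o: "U q * incl_mat d 0 (d0 + d1) = incl_mat d 0 (d0 + d1) * dsum (U0 q) (U1 q)"
      unfolding U_def d_def by (rule dsum_mult_incl(1)[OF ds Uq(3)])
    show "U q * i0 = i0 * U0 q"
      unfolding e
      by (rule intertwine_mult[OF c incl_mat_carrier incl_mat_carrier ds Uq(1) o dsum_mult_incl(1)[OF Uq(1,2)]])
    show "U q * i1 = i1 * U1 q"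
      unfolding e
      by (rule intertwine_mult[OF c incl_mat_carrier incl_mat_carrier ds Uq(2) o dsum_mult_incl(2)[OF Uq(1,2)]])
    show "U q * i2 = i2 * R q"
      unfolding U_def d_def i2_def by (rule dsum_mult_incl(2)[OF ds Uq(3)])
  qed

  \<comment> \<open>Gauge invariance, symmetry and block structure of the three summands\<close>
  have Ew: "E0 * w g = bond_op D0 (u0 g) (u0 g) * E0" "E1 * w g = bond_op D1 (u1 g) (u1 g) * E1"
    if g: "g \<in> carrier G" for g
    unfolding E0_def E1_def w_def u_def D_def
    by (rule leg_proj_bond_op_dsum[OF uc(1,2)[OF g]])+
  have Ec: "E0 * c q = bond_op D0 (v0 q) (v0 q) * E0" "E1 * c q = bond_op D1 (v1 q) (v1 q) * E1"
    if q: "q \<in> carrier Q" for q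
    unfolding E0_def E1_def c_def v_def D_def
    by (rule leg_proj_bond_op_dsum[OF v0[OF q] v1[OF q]])+
  have Kw: "K0 * w g = K0" "K1 * w g = K1" "K2 * w g = K2" if g: "g \<in> carrier G" for g
  proof -
    note b = bond_op_carrier_mat[OF uc(1)[OF g] uc(1)[OF g]]
      bond_op_carrier_mat[OF uc(2)[OF g] uc(2)[OF g]]
    show "K0 * w g = K0"
      unfolding K0_def assoc_mult_mat[OF i(1) AE(1) w'[OF g]] assoc_mult_mat[OF A0 E(1) w'[OF g]]
        Ew[OF g] assoc_mult_mat[symmetric, OF A0 b(1) E(1)] Au0[OF g] ..
    show "K1 * w g = K1"
      unfolding K1_def assoc_mult_mat[OF i(2) AE(2) w'[OF g]] assoc_mult_mat[OF A1 E(2) w'[OF g]]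
        Ew[OF g] assoc_mult_mat[symmetric, OF A1 b(2) E(2)] Au1[OF g] ..
    show "K2 * w g = K2"
      unfolding K2_def assoc_mult_mat[OF i(3) P w'[OF g]] Pw[OF g] ..
  qed
  have UK: "U q * K0 = K0 * c q" "U q * K1 = K1 * c q" "U q * K2 = K2 * c q"
    if q: "q \<in> carrier Q" for q
  proof -
    note b = bond_op_carrier_mat[OF v0[OF q] v0[OF q]] bond_op_carrier_mat[OF v1[OF q] v1[OF q]]
    note Uq = Uc[OF q]
    show "U q * K0 = K0 * c q"
      unfolding K0_def
      by (rule intertwine_mult[OF Uq(4) i(1) AE(1) Uq(1) c'[OF q] Ui(1)[OF q]
            intertwine_mult[OF Uq(1) A0 E(1) b(1) c'[OF q] UA0[OF q] Ec(1)[OF q, symmetric]]])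
    show "U q * K1 = K1 * c q"
      unfolding K1_def
      by (rule intertwine_mult[OF Uq(4) i(2) AE(2) Uq(2) c'[OF q] Ui(2)[OF q]
            intertwine_mult[OF Uq(2) A1 E(2) b(2) c'[OF q] UA1[OF q] Ec(2)[OF q, symmetric]]])
    show "U q * K2 = K2 * c q"
      unfolding K2_def by (rule intertwine_mult[OF Uq(4) i(3) P Uq(3) c'[OF q] Ui(3)[OF q] RP[OF q]])
  qed
  \<comment> \<open>Projecting onto the third physical block isolates \<open>P\<close>, from which
    the left inverse is built.\<close>
  have iK: "transpose_mat i2 * K0 = 0\<^sub>m N N" "transpose_mat i2 * K1 = 0\<^sub>m N N" "transpose_mat i2 * K2 = P"
  proof -
    have t: "transpose_mat i2 \<in> carrier_mat N d" using i by simp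
    have o: "transpose_mat i2 * i0 = 0\<^sub>m N d0" "transpose_mat i2 * i1 = 0\<^sub>m N d1"
      "transpose_mat i2 * i2 = 1\<^sub>m N"
      unfolding i0_def i1_def i2_def
      by (simp_all add: transpose_incl_mult_disjoint transpose_incl_mult_self d_def)
    show "transpose_mat i2 * K0 = 0\<^sub>m N N" "transpose_mat i2 * K1 = 0\<^sub>m N N" "transpose_mat i2 * K2 = P"
      unfolding K0_def K1_def K2_def assoc_mult_mat[symmetric, OF t i(1) AE(1)]
        assoc_mult_mat[symmetric, OF t i(2) AE(2)] assoc_mult_mat[symmetric, OF t i(3) P] o
      by (simp_all add: left_mult_zero_mat[OF AE(1)] left_mult_zero_mat[OF AE(2)] left_mult_one_mat[OF P])
  qed

  \<comment> \<open>The interpolating tensors and the requirements on a path\<close>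
  define A where "A t = complex_of_real (1 - t) \<cdot>\<^sub>m K0 + complex_of_real t \<cdot>\<^sub>m K1
    + complex_of_real (t * (1 - t)) \<cdot>\<^sub>m K2" for t
  have A: "A t \<in> carrier_mat d N" for t
    unfolding A_def using K by simp
  have Aw: "A t * w g = A t" if "g \<in> carrier G" for t g
    unfolding A_def by (simp add: lincomb3_mult[OF w'[OF that] K] Kw[OF that])
  have UA: "U q * A t = A t * c q" if "q \<in> carrier Q" for t q
    unfolding A_def
    by (simp add: lincomb3_mult[OF c'[OF that] K] mult_lincomb3[OF Uc(4)[OF that] K] UK[OF that])
  \<comment> \<open>The coefficient \<open>t * (1 - t)\<close> vanishes at both ends, so only a
    given tensor in its own block remains there.\<close>
  have "A 0 = K0" "A 1 = K1"
    unfolding A_def using K by (auto intro!: eq_matI)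

  have "d0 + d1 \<le> d" by (simp add: d_def)
  moreover have "\<forall>i<d. \<forall>j<D ^ 4. continuous_on {0..1} (\<lambda>t. A t $$ (i, j))"
  proof (intro allI impI)
    fix i j assume "i < d" "j < D ^ 4"
    then have "(\<lambda>t. A t $$ (i, j)) = (\<lambda>t. complex_of_real (1 - t) * K0 $$ (i, j)
        + complex_of_real t * K1 $$ (i, j) + complex_of_real (t * (1 - t)) * K2 $$ (i, j))"
      unfolding A_def using K by (auto simp: N_def)
    then show "continuous_on {0..1} (\<lambda>t. A t $$ (i, j))"
      by (simp only:) (intro continuous_intros)
  qed
  moreover have "peps_state D d (A 0) L M = onsite i0 L M (peps_state D0 d0 A0 L M)"
    "peps_state D d (A 1) L M = onsite i1 L M (peps_state D1 d1 A1 L M)"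
    if "L > 0" "M > 0" for L M
  proof -
    \<comment> \<open>The physical inclusion becomes \<open>onsite\<close>, and the restriction of
      the legs leaves the state unchanged.\<close>
    show "peps_state D d (A 0) L M = onsite i0 L M (peps_state D0 d0 A0 L M)"
      unfolding \<open>A 0 = K0\<close> K0_def
        peps_state_mult_physical[OF i(1) AE(1)[unfolded N_def] that]
      unfolding E0_def by (subst peps_state_leg_proj[OF A0 _ that]) (simp_all add: D_def)
    show "peps_state D d (A 1) L M = onsite i1 L M (peps_state D1 d1 A1 L M)"
      unfolding \<open>A 1 = K1\<close> K1_def
        peps_state_mult_physical[OF i(2) AE(2)[unfolded N_def] that]
      unfolding E1_def by (subst peps_state_leg_proj[OF A1 _ that]) (simp_all add: D_def)
  qed
  moreover have "G_injective G D d (A t)" if t: "t \<in> {0<..<1}" for t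
  proof -
    \<comment> \<open>Projection onto the third block, divided by its coefficient, which is nonzero
      for \<open>t\<close> strictly between 0 and 1.\<close>
    let ?B = "complex_of_real (1 / (t * (1 - t))) \<cdot>\<^sub>m transpose_mat i2"
    have tB: "transpose_mat i2 \<in> carrier_mat N d" using i by simp
    have "?B * A t = complex_of_real (1 / (t * (1 - t))) \<cdot>\<^sub>m (transpose_mat i2 * A t)"
      by (rule mult_smult_assoc_mat[OF tB A])
    also have "\<dots> = P"
      unfolding A_def mult_lincomb3[OF tB K] iK using P t by (intro eq_matI) auto
    finally have "?B * A t = P" .
    moreover have "?B \<in> carrier_mat N d" using tB by simp
    \<comment> \<open>All irreducible representations already occur in \<open>u0\<close>.\<close>
    moreover have "contains_rep G D u n \<rho>" if "irreducible_rep G n \<rho>" for n \<rho>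
      using contains_rep_dsum[OF irr0[OF that] u0 u1] that
      unfolding u_def [abs_def] D_def by (simp add: irreducible_rep_def)
    ultimately have "G_injective_wrt G D d (A t) u"
      unfolding G_injective_wrt_def N_def[symmetric] w_def[symmetric] average_def[symmetric] P_def[symmetric]
      using A[of t] u Aw[of _ t] by (intro conjI allI impI ballI bexI[of _ ?B]) simp_all
    then show ?thesis by (auto simp: G_injective_def)
  qed
  moreover have "onsite (U q) L M (peps_state D d (A t) L M) = peps_state D d (A t) L M"
    if "q \<in> carrier Q" "L > 0" "M > 0" for q L M t
    by (rule onsite_peps_state_symmetric[OF A[unfolded N_def] Uc(4)[OF that(1)] v[OF that(1)]
          UA[OF that(1), unfolded c_def] that(2,3)])
  ultimately have "symmetric_path G Q D0 d0 A0 U0 D1 d1 A1 U1 D d A U"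
    unfolding symmetric_path_def i0_def[symmetric] i1_def[symmetric]
    using U Ui(1,2) A[unfolded N_def] by (intro conjI ballI allI impI) simp_all
  then show ?thesis by blast
qed

theorem theorem3p2:
  fixes G :: "('g, 'x) monoid_scheme" and Q :: "('q, 'y) monoid_scheme"
    and D0 d0 D1 d1 :: nat
    and A0 A1 :: "complex mat"
    and u0 u1 :: "'g \<Rightarrow> complex mat"
    and U0 U1 v0 v1 :: "'q \<Rightarrow> complex mat"
    and \<phi>0 \<phi>1 :: "'q \<Rightarrow> 'g \<Rightarrow> 'g"
    and \<omega>0 \<omega>1 :: "'q \<Rightarrow> 'q \<Rightarrow> 'g"
  assumes "group G" and "finite (carrier G)"
    and "group Q" and "finite (carrier Q)"
    and "symmetric_peps G Q D0 d0 A0 u0 U0 v0 \<phi>0 \<omega>0"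
    and "symmetric_peps G Q D1 d1 A1 u1 U1 v1 \<phi>1 \<omega>1"
    and "same_class G Q \<phi>0 \<omega>0 \<phi>1 \<omega>1"
  shows "\<exists>D d A U. symmetric_path G Q D0 d0 A0 U0 D1 d1 A1 U1 D d A U"
proof -
  \<comment> \<open>The second tensor is regauged to the maps of the first, after which both share
    \<phi>0 and \<omega>0.\<close>
  obtain v1' where "symmetric_peps G Q D1 d1 A1 u1 U1 v1' \<phi>0 \<omega>0"
    using symmetric_peps_regauge[OF assms(1,3,6,7)] assms(5) by (auto simp: symmetric_peps_def)
  from symmetric_path_exists[OF assms(1-3,5) this] show ?thesis .
qed

end
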